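(* Let $q$ be a power of $2$ and let $M$ be a maximal arc of degree $d<q/2$ of Mathon type in $\mathrm{PG}(2,q)$, consisting of $d-1$ conics on a common nucleus $n$ (together with $n$). Let $C_d$ be a conic disjoint from $M$ with the same nucleus $n$. Then there is a unique maximal arc of degree $2d$ of Mathon type containing $M\cup C_d$.
   Context: Let $q$ be a power of $2$ and $\mathrm{Tr}:\mathrm{GF}(q)\to\mathrm{GF}(2)$ the absolute trace. A maximal arc of degree $d$ in $\mathrm{PG}(2,q)$ is a non-empty proper set of points meeting every line in $0$ or $d$ points; the trivial cases (a single point, or an affine plane $d=q$) are excluded. Conics are non-degenerate; for $q$ even the tangent lines of a conic all pass through a common point, its nucleus. For $\alpha,\beta,\lambda\in\mathrm{GF}(q)$ with $\mathrm{Tr}(\alpha\beta)=1$ let $F_{\alpha,\beta,\lambda}=\{(x,y,z):\alpha x^2+xy+\beta y^2+\lambda z^2=0\}$. For $\lambda\ne0$ this is a non-degenerate conic with nucleus $F_0=(0,0,1)$, and the line $z=0$ is external to it. For $\lambda\ne\lambda'$ define $F_{\alpha,\beta,\lambda}\oplus F_{\alpha',\beta',\lambda'}=F_{\alpha'',\beta'',\lambda''}$ with $\alpha''=\frac{\alpha\lambda+\alpha'\lambda'}{\lambda+\lambda'}$, $\beta''=\frac{\beta\lambda+\beta'\lambda'}{\lambda+\lambda'}$, $\lambda''=\lambda+\lambda'$. A set $\mathcal C$ of such conics ($\lambda\neq0$, distinct members having distinct $\lambda$) is closed if the composition of any two distinct members is again a member of $\mathcal C$ (in particular the parameters of the composition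 satisfy the trace condition). For closed $\mathcal C$ the union of the conics of $\mathcal C$ together with $F_0$ is a maximal arc of degree $|\mathcal C|+1$; a maximal arc which, after a change of coordinates of the plane, arises in this way from a non-empty closed set is called of Mathon type. *)

theory Defs
  imports "HOL-Analysis.Analysis"
begin

text \<open>
  PG(2,q) over a finite field \<open>'a\<close> with q elements: points and lines are the subspaces of
  \<open>'a^3\<close> of dimension 1 and 2, and a point lies on a line iff it is a subset of it.
\<close>

definition pg_points :: "('a::field^3) set set" where
  "pg_points = {p. vec.subspace p \<and> vec.dim p = 1}"

definition pg_lines :: "('a::field^3) set set" where
  "pg_lines = {l. vec.subspace l \<and> vec.dim l = 2}"

definition points_on :: "('a::field^3) set set \<Rightarrow> ('a^3) set \<Rightarrow> ('a^3) set set" where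
  "points_on M l = {p \<in> M. p \<subseteq> l}"

text \<open>
  The last two conditions exclude the trivial arcs (\<open>d = 1\<close> forces a single point); \<open>d = 0\<close> is
  impossible because \<open>M\<close> is nonempty.
\<close>

definition maximal_arc :: "nat \<Rightarrow> ('a::{field,finite}^3) set set \<Rightarrow> bool" where
  "maximal_arc d M \<longleftrightarrow>
     M \<subset> pg_points \<and> M \<noteq> {} \<and>
     (\<forall>l \<in> pg_lines. card (points_on M l) \<in> {0, d}) \<and>
     d \<noteq> 1 \<and> d \<noteq> CARD('a)"

text \<open>
  Every ternary quadratic form is \<open>qform A\<close> for some, not necessarily symmetric, matrix \<open>A\<close>.
  Since the characteristic may be 2, the form itself and not only its polar form enters the
  notion of non-degeneracy: there is no nonzero vector in the radical of the polar form on which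
  the quadratic form vanishes. Over a finite field this is the absence of singular points.
\<close>

definition qform :: "'a::field^3^3 \<Rightarrow> 'a^3 \<Rightarrow> 'a" where
  "qform A v = (\<Sum>i\<in>UNIV. \<Sum>j\<in>UNIV. A $ i $ j * v $ i * v $ j)"

definition polar_form :: "'a::field^3^3 \<Rightarrow> 'a^3 \<Rightarrow> 'a^3 \<Rightarrow> 'a" where
  "polar_form A v w = qform A (v + w) - qform A v - qform A w"

definition nondegenerate :: "'a::field^3^3 \<Rightarrow> bool" where
  "nondegenerate A \<longleftrightarrow> (\<forall>v. qform A v = 0 \<and> (\<forall>w. polar_form A v w = 0) \<longrightarrow> v = 0)"

definition is_conic :: "('a::field^3) set set \<Rightarrow> bool" where
  "is_conic C \<longleftrightarrow> (\<exists>A. nondegenerate A \<and> C = {p \<in> pg_points. \<forall>v\<in>p. qform A v = 0})"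

definition tangent_line :: "('a::field^3) set set \<Rightarrow> ('a^3) set \<Rightarrow> bool" where
  "tangent_line C l \<longleftrightarrow> l \<in> pg_lines \<and> card (points_on C l) = 1"

definition is_nucleus :: "('a::field^3) set set \<Rightarrow> ('a^3) set \<Rightarrow> bool" where
  "is_nucleus C n \<longleftrightarrow> n \<in> pg_points \<and> (\<forall>l. tangent_line C l \<longrightarrow> n \<subseteq> l)"

text \<open>
  The absolute trace, with values in the prime field \<open>{0, 1}\<close>; meaningful only if \<open>CARD('a)\<close> is a
  power of 2.
\<close>

definition abs_trace :: "'a::{field,finite} \<Rightarrow> 'a" where
  "abs_trace x = (\<Sum>i < (THE h. CARD('a) = 2 ^ h). x ^ (2 ^ i))"

text \<open>
  The triple \<open>(\<alpha>, \<beta>, \<mu>)\<close> stands for the conic with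
  equation \<open>\<alpha>x\<^sup>2 + xy + \<beta>y\<^sup>2 + \<mu>z\<^sup>2 = 0\<close>
  (the parameter \<open>\<mu>\<close> is usually written \<open>\<lambda>\<close>, which is reserved syntax). The point \<open>F0\<close> is (0,0,1).
\<close>

type_synonym 'a mathon_param = "'a \<times> 'a \<times> 'a"

definition mathon_conic :: "'a::field mathon_param \<Rightarrow> ('a^3) set set" where
  "mathon_conic = (\<lambda>(\<alpha>, \<beta>, \<mu>). {p \<in> pg_points. \<forall>v\<in>p.
     \<alpha> * (v $ 1)\<^sup>2 + v $ 1 * v $ 2 + \<beta> * (v $ 2)\<^sup>2 + \<mu> * (v $ 3)\<^sup>2 = 0})"

definition F0 :: "('a::field^3) set" where
  "F0 = vec.span {vector [0, 0, 1]}"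

definition mathon_compose :: "'a::field mathon_param \<Rightarrow> 'a mathon_param \<Rightarrow> 'a mathon_param" where
  "mathon_compose = (\<lambda>(\<alpha>, \<beta>, \<mu>) (\<alpha>', \<beta>', \<mu>').
     ((\<alpha> * \<mu> + \<alpha>' * \<mu>') / (\<mu> + \<mu>'), (\<beta> * \<mu> + \<beta>' * \<mu>') / (\<mu> + \<mu>'), \<mu> + \<mu>'))"

definition closed_mathon_set :: "'a::{field,finite} mathon_param set \<Rightarrow> bool" where
  "closed_mathon_set P \<longleftrightarrow>
     (\<forall>(\<alpha>, \<beta>, \<mu>) \<in> P. abs_trace (\<alpha> * \<beta>) = 1 \<and> \<mu> \<noteq> 0) \<and>
     inj_on (\<lambda>(\<alpha>, \<beta>, \<mu>). \<mu>) P \<and>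
     (\<forall>F\<in>P. \<forall>F'\<in>P. F \<noteq> F' \<longrightarrow> mathon_compose F F' \<in> P)"

definition mathon_point_set :: "'a::field mathon_param set \<Rightarrow> ('a^3) set set" where
  "mathon_point_set P = insert F0 (\<Union>F\<in>P. mathon_conic F)"

text \<open>
  A change of coordinates is given by an invertible matrix acting on the points, i.e. on
  subspaces of dimension 1.
\<close>

definition change_coords :: "'a::field^3^3 \<Rightarrow> ('a^3) set \<Rightarrow> ('a^3) set" where
  "change_coords A p = (\<lambda>v. A *v v) ` p"

definition mathon_type :: "('a::{field,finite}^3) set set \<Rightarrow> bool" where
  "mathon_type M \<longleftrightarrow>
     (\<exists>A P. invertible A \<and> P \<noteq> {} \<and> closed_mathon_set P \<and>
            M = change_coords A ` mathon_point_set P)"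

end

theory Submission
  imports Defs "HOL-Computational_Algebra.Polynomial"
begin

text \<open>
  Coordinatise so that the common nucleus is (0,0,1). A conic with this nucleus has an equation
  \<open>\<alpha>x\<^sup>2 + xy + \<beta>y\<^sup>2 + \<mu>z\<^sup>2 = 0\<close> with \<open>\<mu> \<noteq> 0\<close>, and in terms of \<open>(\<alpha>\<mu>, \<beta>\<mu>, \<mu>)\<close> Mathon's composition is
  addition. The line \<open>z = rx + sy\<close> meets the conic in 0 or 2 points, according to the value of
  \<open>Tr((\<alpha> + \<mu>r\<^sup>2)(\<beta> + \<mu>s\<^sup>2))\<close>. Two conics are disjoint iff the indicator of being secant to a given line
  is additive on them; so, for a group of triples whose conics are pairwise disjoint, it is a
  character for every line, each line not through the nucleus is secant to none or half of the conics,
  and the conics with the nucleus form a maximal arc.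

  The conics of \<open>M\<close> form such a group (with 0), and disjointness from \<open>C\<close> makes the
  group generated by it and \<open>C\<close> again one, of twice the order; an external line of the new arc
  serves as \<open>z = 0\<close>. By additivity, a line external to \<open>M\<close> and \<open>C\<close> is external to this
  arc. As a maximal arc is determined by its external lines, any maximal arc of degree \<open>2d\<close>
  containing \<open>M \<union> C\<close> coincides with it.
\<close>

section \<open>Finite fields of even order\<close>

locale even_order_field =
  fixes h :: nat and T :: "'a::{field,finite} itself"
  assumes card_field: "CARD('a) = 2 ^ h"
begin

section \<open>Arithmetic in characteristic 2\<close>

lemma two_eq_0 [simp]: "(2::'a) = 0"
proof -
  \<comment> \<open>Translation by 1 permutes the field, so adding 1 to each of the
    \<open>2 ^ h\<close> summands does not change the total.\<close>
  have "(\<Sum>x\<in>UNIV. x) = (\<Sum>x\<in>UNIV. x + (1::'a))"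
    by (rule sum.reindex_bij_witness[of _ "\<lambda>x. x + 1" "\<lambda>x. x - 1"]) auto
  then have "of_nat (2 ^ h) = (0::'a)"
    by (simp add: sum.distrib card_field)
  then show ?thesis by simp
qed

lemma add_self [simp]: "x + x = (0::'a)"
  by (metis mult_2 mult_zero_left two_eq_0)

lemma add_self_left [simp]: "x + (x + y) = (y::'a)"
  by (simp flip: add.assoc)

lemma uminus_eq [simp]: "- x = (x::'a)"
  by (metis add_self add_eq_0_iff)

lemma diff_eq_add [simp]: "x - y = x + (y::'a)"
  by (metis uminus_eq diff_conv_add_uminus)

lemma add_eq_0_iff_eq: "x + y = 0 \<longleftrightarrow> x = (y::'a)"
  by (metis add_eq_0_iff uminus_eq)

lemma add_eq_iff: "x + y = z \<longleftrightarrow> x = y + (z::'a)"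
  by (metis add_self_left add.commute)

lemma add_square: "(x + y)\<^sup>2 = x\<^sup>2 + (y::'a)\<^sup>2"
  by (simp add: power2_sum two_eq_0)

lemma add_power_2_power: "(x + y) ^ (2 ^ i) = x ^ (2 ^ i) + (y::'a) ^ (2 ^ i)"
proof (induction i)
  case (Suc i)
  have "z ^ (2 ^ Suc i) = (z ^ (2 ^ i))\<^sup>2" for z :: 'a
    by (simp add: mult.commute flip: power_mult)
  then show ?case using Suc by (simp add: add_square)
qed auto

lemma square_eq_iff_eq: "x\<^sup>2 = y\<^sup>2 \<longleftrightarrow> x = (y::'a)"
proof
  assume "x\<^sup>2 = y\<^sup>2"
  then have "(x + y)\<^sup>2 = 0" by (simp add: add_square)
  then show "x = y" by (simp add: add_eq_0_iff_eq)
qed simp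

text \<open>Squaring is injective in characteristic 2, hence bijective on a finite field. This is
  what lets the coordinate z be recovered from its square later on.\<close>

lemma ex_sqrt: "\<exists>y. y\<^sup>2 = (x::'a)"
proof -
  have "inj (\<lambda>y::'a. y\<^sup>2)" by (rule injI) (simp add: square_eq_iff_eq)
  then have "surj (\<lambda>y::'a. y\<^sup>2)" by (simp add: finite_UNIV_inj_surj)
  then show ?thesis by (metis surjD)
qed

definition sqroot :: "'a \<Rightarrow> 'a" where
  "sqroot x = (SOME y. y\<^sup>2 = x)"

lemma sqroot_square [simp]: "(sqroot x)\<^sup>2 = x"
  unfolding sqroot_def using ex_sqrt by (rule someI_ex)

text \<open>Multiplication by a nonzero x permutes the nonzero elements; comparing the products of
  all of them gives x^(q-1) = 1.\<close>

lemma field_power_card: "(x::'a) ^ CARD('a) = x"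
proof (cases "x = 0")
  case False
  have "(\<Prod>y\<in>-{0}. x * y) = \<Prod>(-{0::'a})"
    by (rule prod.reindex_bij_witness[of _ "\<lambda>y. y / x" "\<lambda>y. x * y"]) (use False in auto)
  then have "x ^ (CARD('a) - 1) * \<Prod>(-{0::'a}) = \<Prod>(-{0::'a})"
    by (simp add: prod.distrib Compl_eq_Diff_UNIV card_Diff_singleton)
  moreover have "\<Prod>(-{0::'a}) \<noteq> 0" by (simp add: prod_zero_iff)
  ultimately have "x ^ (CARD('a) - 1) = 1" by simp
  then show ?thesis
    by (metis mult.right_neutral power_minus_mult zero_less_card_finite mult_1)
qed simp

section \<open>The absolute trace and binary quadratic forms\<close>

lemma abs_trace_eq: "abs_trace (x::'a) = (\<Sum>i<h. x ^ (2 ^ i))"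
proof -
  have "(THE k. CARD('a) = 2 ^ k) = h"
    by (rule the_equality) (auto simp: card_field)
  then show ?thesis by (simp add: abs_trace_def)
qed

lemma abs_trace_add: "abs_trace (x + y) = abs_trace x + abs_trace (y::'a)"
  by (simp add: abs_trace_eq add_power_2_power sum.distrib)

lemma abs_trace_0 [simp]: "abs_trace (0::'a) = 0"
  by (simp add: abs_trace_eq power_0_left)

text \<open>Squaring shifts the summands by one place, and x^q = x closes the cycle. As squaring is
  also additive, the trace equals its own square and so is 0 or 1.\<close>

lemma abs_trace_square: "abs_trace (x\<^sup>2) = abs_trace (x::'a)"
proof -
  have "abs_trace (x\<^sup>2) = (\<Sum>i<h. x ^ (2 ^ Suc i))"
    by (simp add: abs_trace_eq flip: power_mult)
  also have "\<dots> = (\<Sum>i<Suc h. x ^ (2 ^ i)) - x"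
    by (subst sum.lessThan_Suc_shift) simp
  also have "\<dots> = (\<Sum>i<h. x ^ (2 ^ i)) + x ^ (2 ^ h) - x"
    by simp
  also have "x ^ (2 ^ h) = x" by (metis card_field field_power_card)
  finally show ?thesis by (simp add: abs_trace_eq add.assoc)
qed

lemma square_abs_trace: "(abs_trace x)\<^sup>2 = abs_trace (x::'a)"
proof -
  have "(\<Sum>i\<in>A. f i)\<^sup>2 = (\<Sum>i\<in>A. (f i)\<^sup>2)" if "finite A" for f :: "nat \<Rightarrow> 'a" and A
    using that by induction (auto simp: add_square)
  then have "(abs_trace x)\<^sup>2 = abs_trace (x\<^sup>2)"
    by (simp add: abs_trace_eq flip: power_mult) (simp add: mult.commute)
  then show ?thesis by (simp add: abs_trace_square)
qed

lemma abs_trace_cases: "abs_trace (x::'a) = 0 \<or> abs_trace x = 1"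
  using square_abs_trace[of x] by (metis mult_cancel_left2 power2_eq_square)

text \<open>Both sides have \<open>q/2\<close> elements: the left one is the zero set of a polynomial of degree
  \<open>q/2\<close>, the right one the image of an additive map with kernel \<open>{0, 1}\<close>.\<close>

lemma abs_trace_eq_0_iff: "abs_trace (x::'a) = 0 \<longleftrightarrow> (\<exists>t. t\<^sup>2 + t = x)"
proof -
  define I where "I = range (\<lambda>t::'a. t\<^sup>2 + t)"
  define K where "K = {x::'a. abs_trace x = 0}"
  define p where "p = (\<Sum>i<h. monom (1::'a) (2 ^ i))"
  have "h \<noteq> 0"
    using card_field card_mono[of UNIV "{0, 1::'a}"] by (intro notI) auto
  then obtain k where k: "h = Suc k" by (cases h) auto
  have deg: "degree p \<le> 2 ^ k"
    unfolding p_def by (intro degree_sum_le order.trans[OF degree_monom_le]) (auto simp: k)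
  have "coeff p (2 ^ k) = (\<Sum>i<h. if i = k then 1 else 0)"
    unfolding p_def coeff_sum by (intro sum.cong) auto
  then have "p \<noteq> 0" by (auto simp: k)
  have K: "K = {x. poly p x = 0}"
    by (simp add: K_def p_def poly_sum poly_monom abs_trace_eq)
  then have cK: "card K \<le> 2 ^ k"
    using card_poly_roots_bound[OF \<open>p \<noteq> 0\<close>] deg by simp
  \<comment> \<open>Two elements of a fibre of t^2 + t differ by 0 or 1, so the field is covered by
    \<open>card I\<close> fibres of size at most 2. Hence \<open>card I\<close> is at least q/2, the
    bound already found for \<open>card K\<close> from above.\<close>
  have "(UNIV::'a set) = (\<Union>y\<in>I. {t. t\<^sup>2 + t = y})" by (auto simp: I_def)
  then have "CARD('a) \<le> (\<Sum>y\<in>I. card {t::'a. t\<^sup>2 + t = y})"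
    by (metis card_UN_le finite)
  also have "\<dots> \<le> (\<Sum>y\<in>I. 2)"
  proof (rule sum_mono)
    fix y assume "y \<in> I"
    then obtain s where s: "y = s\<^sup>2 + s" by (auto simp: I_def)
    have "{t::'a. t\<^sup>2 + t = y} \<subseteq> {s, s + 1}"
    proof
      fix t assume "t \<in> {t. t\<^sup>2 + t = y}"
      then have t: "t\<^sup>2 + t = y" by simp
      have "(t + s) * (t + (s + 1)) = (t\<^sup>2 + t) + (s\<^sup>2 + s)"
        by (simp add: algebra_simps power2_eq_square)
      also have "\<dots> = 0" using t s by simp
      finally show "t \<in> {s, s + 1}" by (simp add: add_eq_0_iff_eq)
    qed
    then have "card {t::'a. t\<^sup>2 + t = y} \<le> card {s, s + 1}" by (intro card_mono) auto
    also have "\<dots> \<le> 2" by (simp add: card_insert_if)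
    finally show "card {t::'a. t\<^sup>2 + t = y} \<le> 2" .
  qed
  finally have "card K \<le> card I" using cK by (simp add: card_field k)
  moreover have "I \<subseteq> K" by (auto simp: I_def K_def abs_trace_add abs_trace_square)
  ultimately have "I = K" by (intro card_seteq) auto
  then have "x \<in> K \<longleftrightarrow> x \<in> I" by simp
  then show ?thesis by (auto simp: I_def K_def image_iff)
qed

text \<open>A zero (x, y) yields the linear factor y s + x t; comparing coefficients dictates the
  other factor. The condition \<open>x * m + y * k = 1\<close> is the coefficient of st, and it says
  that the two factors are linearly independent.\<close>

lemma binary_form_factor:
  fixes a b :: 'a
  assumes "a * x\<^sup>2 + x * y + b * y\<^sup>2 = 0" "(x, y) \<noteq> (0, 0)"
  obtains m k where "\<And>s t. a * s\<^sup>2 + s * t + b * t\<^sup>2 = (y * s + x * t) * (m * s + k * t)"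
    "x * m + y * k = 1"
proof -
  obtain m k where mk: "y * m = a" "x * k = b" "x * m + y * k = 1"
  proof (cases "y = 0")
    case True
    with assms have "a = 0" "x \<noteq> 0" by auto
    then show ?thesis using True that[of "1 / x" "b / x"] by simp
  next
    case False
    have e: "b * y\<^sup>2 = a * x\<^sup>2 + x * y"
      using assms(1) by (metis add_eq_0_iff_eq)
    have "x * ((1 + x * (a / y)) / y) = (a * x\<^sup>2 + x * y) / y\<^sup>2"
      using False by (simp add: field_simps power2_eq_square)
    also have "\<dots> = b" using False by (simp flip: e)
    finally show ?thesis using False that[of "a / y" "(1 + x * (a / y)) / y"]
      by (simp add: add.left_commute)
  qed
  have "a * s\<^sup>2 + s * t + b * t\<^sup>2 = (y * s + x * t) * (m * s + k * t)" for s t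
  proof -
    have "(y * s + x * t) * (m * s + k * t) =
        (y * m) * s\<^sup>2 + (x * m + y * k) * (s * t) + (x * k) * t\<^sup>2"
      by (simp add: algebra_simps power2_eq_square)
    then show ?thesis by (simp add: mk)
  qed
  then show ?thesis using mk that by blast
qed

text \<open>For y \<noteq> 0 the substitution t = a x / y turns a zero of the form into a solution
  of t^2 + t = a b, which exists iff the trace of a b vanishes.\<close>

lemma binary_form_isotropic_iff:
  fixes a b :: 'a
  shows "(\<exists>x y. (x, y) \<noteq> (0, 0) \<and> a * x\<^sup>2 + x * y + b * y\<^sup>2 = 0) \<longleftrightarrow> abs_trace (a * b) = 0"
proof
  assume "\<exists>x y. (x, y) \<noteq> (0, 0) \<and> a * x\<^sup>2 + x * y + b * y\<^sup>2 = 0"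
  then obtain x y where xy: "(x, y) \<noteq> (0, 0)" "a * x\<^sup>2 + x * y + b * y\<^sup>2 = 0" by blast
  show "abs_trace (a * b) = 0"
  proof (cases "y = 0")
    case True
    then show ?thesis using xy by auto
  next
    case False
    have "(a * x / y)\<^sup>2 + a * x / y = a * (a * x\<^sup>2 + x * y) / y\<^sup>2"
      using False by (simp add: field_simps power2_eq_square)
    also have "a * x\<^sup>2 + x * y = b * y\<^sup>2"
      using xy(2) by (metis add_eq_0_iff_eq)
    finally have "(a * x / y)\<^sup>2 + a * x / y = a * b" using False by simp
    then show ?thesis using abs_trace_eq_0_iff by blast
  qed
next
  assume "abs_trace (a * b) = 0"
  then obtain t where t: "t\<^sup>2 + t = a * b" using abs_trace_eq_0_iff by blast
  show "\<exists>x y. (x, y) \<noteq> (0, 0) \<and> a * x\<^sup>2 + x * y + b * y\<^sup>2 = 0"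
  proof (cases "a = 0")
    case True
    then show ?thesis by (intro exI[of _ 1] exI[of _ 0]) auto
  next
    case False
    have "a * (t / a)\<^sup>2 + (t / a) * 1 + b * 1\<^sup>2 = (t\<^sup>2 + t + a * b) / a"
      using False by (simp add: field_simps power2_eq_square)
    also have "\<dots> = 0" using t by simp
    finally show ?thesis by (intro exI[of _ "t / a"] exI[of _ 1]) auto
  qed
qed

end

section \<open>The plane and its lines\<close>

lemma vec3_eq_iff: "v = w \<longleftrightarrow> v $ 1 = w $ 1 \<and> v $ 2 = w $ 2 \<and> v $ 3 = (w :: 'a^3) $ 3"
  by (simp add: vec_eq_iff forall_3)

lemma vector3_eq_0_iff: "vector [a, b, c] = (0 :: 'a::zero^3) \<longleftrightarrow> a = 0 \<and> b = 0 \<and> c = 0"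
  by (simp add: vec3_eq_iff)

lemma pg_points_iff: "p \<in> pg_points \<longleftrightarrow> (\<exists>v. v \<noteq> 0 \<and> p = vec.span {v})"
proof
  assume "p \<in> pg_points"
  then have p: "vec.subspace p" "vec.dim p = 1" by (auto simp: pg_points_def)
  obtain B where B: "B \<subseteq> p" "vec.independent B" "p \<subseteq> vec.span B" "card B = 1"
    using vec.basis_exists[of p] p(2) by metis
  then obtain v where v: "B = {v}" by (auto simp: card_1_singleton_iff)
  then have "v \<noteq> 0" using B(2) by simp
  moreover have "p = vec.span {v}"
    using B p(1) v by (metis subset_antisym vec.span_minimal)
  ultimately show "\<exists>v. v \<noteq> 0 \<and> p = vec.span {v}" by blast
next
  assume "\<exists>v. v \<noteq> 0 \<and> p = vec.span {v}"
  then obtain v where "v \<noteq> 0" "p = vec.span {v}" by blast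
  then show "p \<in> pg_points"
    by (simp add: pg_points_def vec.dim_span_eq_card_independent del: vec.dim_span)
qed

lemma span_subset_iff: "vec.subspace l \<Longrightarrow> vec.span {v} \<subseteq> l \<longleftrightarrow> v \<in> l"
  by (meson empty_subsetI insert_subset subset_trans vec.span_minimal vec.span_superset)

lemma span_singleton_eqI:
  "w \<in> vec.span {v} \<Longrightarrow> w \<noteq> 0 \<Longrightarrow> vec.span {w} = vec.span {v::'a::field^'n}"
proof -
  assume w: "w \<in> vec.span {v}" "w \<noteq> 0"
  then obtain k where k: "w = k *s v" by (auto simp: vec.span_singleton)
  then have "k \<noteq> 0" using w by auto
  then have "v = inverse k *s w" using k by simp
  then have "v \<in> vec.span {w}" by (auto simp: vec.span_singleton)
  then show ?thesis using w(1)
    by (intro equalityI) (simp_all add: span_subset_iff)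
qed

lemma pg_points_spanI: "v \<noteq> 0 \<Longrightarrow> vec.span {v} \<in> pg_points"
  by (auto simp: pg_points_iff)

lemma subspace_pg_line: "l \<in> pg_lines \<Longrightarrow> vec.subspace l"
  by (simp add: pg_lines_def)

lemma span2_pg_line:
  fixes u v :: "'a::field^3"
  assumes "u \<noteq> 0" "v \<notin> vec.span {u}"
  shows "vec.span {u, v} \<in> pg_lines"
proof -
  have "vec.independent {v, u}"
    using assms by (subst vec.independent_insert) (auto intro: vec.span_base)
  then have "vec.dim (vec.span {v, u}) = card {v, u}" by (rule vec.dim_span_eq_card_independent)
  also have "\<dots> = 2" using assms by (auto simp: card_insert_if intro: vec.span_base)
  finally show ?thesis by (simp add: pg_lines_def insert_commute)
qed

lemma pg_line_eq_span2:
  fixes u v :: "'a::field^3"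
  assumes "l \<in> pg_lines" "u \<in> l" "v \<in> l" "u \<noteq> 0" "v \<notin> vec.span {u}"
  shows "l = vec.span {u, v}"
proof -
  have "vec.span {u, v} \<subseteq> l"
    using assms(1-3) by (intro vec.span_minimal) (auto simp: pg_lines_def)
  then show ?thesis
    using span2_pg_line[OF assms(4,5)] assms(1)
    by (intro vec.subspace_dim_equal[symmetric]) (auto simp: pg_lines_def)
qed

lemma ex1_line_through:
  assumes "p \<in> pg_points" "p' \<in> pg_points" "p \<noteq> p'"
  shows "\<exists>!l. l \<in> pg_lines \<and> p \<subseteq> l \<and> p' \<subseteq> l"
proof -
  obtain u v where uv: "u \<noteq> 0" "v \<noteq> 0" "p = vec.span {u}" "p' = vec.span {v}"
    using assms by (auto simp: pg_points_iff)
  have "v \<notin> vec.span {u}" using uv assms(3) span_singleton_eqI by metis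
  then have l: "vec.span {u, v} \<in> pg_lines" "l = vec.span {u, v}"
    if "l \<in> pg_lines" "u \<in> l" "v \<in> l" for l
    using span2_pg_line[of u v] pg_line_eq_span2[of l u v] uv(1) that by blast+
  show ?thesis
  proof (rule ex1I[of _ "vec.span {u, v}"])
    have "vec.span {u, v} \<in> pg_lines" using span2_pg_line uv(1) \<open>v \<notin> vec.span {u}\<close> by blast
    then show "vec.span {u, v} \<in> pg_lines \<and> p \<subseteq> vec.span {u, v} \<and> p' \<subseteq> vec.span {u, v}"
      unfolding uv(3,4) by (simp add: vec.span_mono)
  next
    fix l assume "l \<in> pg_lines \<and> p \<subseteq> l \<and> p' \<subseteq> l"
    then have "l \<in> pg_lines" "u \<in> l" "v \<in> l" using uv
      by (metis span_subset_iff subspace_pg_line)+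
    then show "l = vec.span {u, v}" by (rule l(2))
  qed
qed

text \<open>Homogeneous line coordinates. With all three zero this is the whole space, hence the
  side condition in later lemmas.\<close>

definition proj_line :: "'a::field \<Rightarrow> 'a \<Rightarrow> 'a \<Rightarrow> ('a^3) set" where
  "proj_line a b c = {v. a * v $ 1 + b * v $ 2 + c * v $ 3 = 0}"

lemma subspace_proj_line: "vec.subspace (proj_line a b c)"
proof -
  have e: "a * (k * x) + b * (k * y) + c * (k * z) = k * (a * x + b * y + c * z)" for k x y z
    by (simp add: algebra_simps)
  show ?thesis
    unfolding vec.subspace_def proj_line_def
    by (simp add: e) (simp add: algebra_simps add_eq_0_iff)
qed

text \<open>The kernel of a nonzero functional together with one vector outside it spans the space,
  so its dimension is 2.\<close>

lemma proj_line_in_pg_lines: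
  assumes "(a, b, c) \<noteq> (0, 0, 0)"
  shows "proj_line a b c \<in> pg_lines"
proof -
  define f where "f v = a * v $ 1 + b * v $ 2 + c * v $ 3" for v :: "'a^3"
  have f: "v \<in> proj_line a b c \<longleftrightarrow> f v = 0" for v by (simp add: f_def proj_line_def)
  have "\<exists>x. f x \<noteq> 0"
    using assms unfolding f_def
    by (metis add.left_neutral add.right_neutral mult_zero_right mult.right_neutral vector_3)
  then obtain x where x: "f x \<noteq> 0" ..
  have "v \<in> vec.span (insert x (proj_line a b c))" for v
  proof -
    have "f (v - k *s x) = f v - k * f x" for k
      by (simp add: f_def algebra_simps)
    then have "f (v - (f v / f x) *s x) = f v - (f v / f x) * f x" .
    also have "\<dots> = 0" using x by simp
    finally have "v - (f v / f x) *s x \<in> vec.span (proj_line a b c)"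
      by (intro vec.span_base) (simp add: f)
    then show ?thesis by (auto simp: vec.span_breakdown_eq)
  qed
  then have "vec.span (insert x (proj_line a b c)) = UNIV" by blast
  then have "vec.dim (insert x (proj_line a b c)) = CARD(3)"
    by (metis vec.dim_span vec_dim_card)
  moreover have "x \<notin> vec.span (proj_line a b c)"
    using x by (simp add: f vec.span_eq_iff[THEN iffD2] subspace_proj_line)
  ultimately have "vec.dim (proj_line a b c) = 2" by (simp add: vec.dim_insert)
  then show ?thesis by (simp add: pg_lines_def subspace_proj_line)
qed

text \<open>A basis of the line is extended by a vector outside it, and a functional is prescribed
  to vanish on the basis but not on that vector. Its kernel contains the line and has the same
  dimension.\<close>

lemma pg_lineE:
  fixes l :: "('a::field^3) set"
  assumes "l \<in> pg_lines"
  obtains a b c where "(a, b, c) \<noteq> (0, 0, 0)" "l = proj_line a b c"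
proof -
  have l: "vec.subspace l" "vec.dim l = 2" using assms by (auto simp: pg_lines_def)
  obtain B where B: "B \<subseteq> l" "vec.independent B" "l \<subseteq> vec.span B"
    using vec.basis_exists[of l] by metis
  have "l \<noteq> UNIV"
  proof
    assume "l = UNIV"
    then have "vec.dim l = CARD(3)" by (simp only: vec_dim_card)
    then show False using l by simp
  qed
  then obtain x where x: "x \<notin> l" by auto
  then have "x \<notin> vec.span B" using B l(1) vec.span_minimal by blast
  then have "vec.independent (insert x B)" using B(2) by (simp add: vec.independent_insert)
  \<comment> \<open>The functional is the first coordinate of \<open>g\<close>, so that it takes the
    value 1 at \<open>x\<close>.\<close>
  then obtain g :: "'a^3 \<Rightarrow> 'a^3" where g: "Vector_Spaces.linear (*s) (*s) g"
      "\<forall>y\<in>insert x B. g y = (if y = x then axis 1 1 else 0)"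
    using vec.linear_independent_extend[of "insert x B" "\<lambda>y. if y = x then axis 1 1 else 0"]
    by blast
  interpret g: Vector_Spaces.linear "(*s)" "(*s)" g by (rule g(1))
  have gl: "g v = 0" if "v \<in> l" for v
  proof -
    have "\<forall>y\<in>B. g y = 0" using g(2) \<open>x \<notin> vec.span B\<close> by (auto dest: vec.span_base)
    then show ?thesis using that B(3)
      by (metis (full_types) g.eq_0_on_span subsetD)
  qed
  define f where "f i = g (axis i 1) $ 1" for i
  have gv: "g v $ 1 = f 1 * v $ 1 + f 2 * v $ 2 + f 3 * v $ 3" for v
  proof -
    have "v = v $ 1 *s axis 1 1 + v $ 2 *s axis 2 1 + v $ 3 *s axis 3 1"
      by (simp add: vec3_eq_iff axis_def)
    then have "g v = v $ 1 *s g (axis 1 1) + v $ 2 *s g (axis 2 1) + v $ 3 *s g (axis 3 1)"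
      by (metis g.add g.scale)
    then show ?thesis by (simp add: f_def mult.commute)
  qed
  have nz: "(f 1, f 2, f 3) \<noteq> (0, 0, 0)"
    using gv[of x] g(2) by (auto simp: axis_def)
  have "l \<subseteq> proj_line (f 1) (f 2) (f 3)"
    using gl by (auto simp: proj_line_def simp flip: gv)
  then have "l = proj_line (f 1) (f 2) (f 3)"
    using proj_line_in_pg_lines[OF nz] l
    by (intro vec.subspace_dim_equal) (auto simp: pg_lines_def)
  then show ?thesis using nz that by blast
qed

section \<open>Changes of coordinates\<close>

lemma change_coords_change_coords: "change_coords A (change_coords B p) = change_coords (A ** B) p"
  by (auto simp: change_coords_def image_image matrix_vector_mul_assoc)

lemma change_coords_mat_1 [simp]: "change_coords (mat 1) p = p"
  by (simp add: change_coords_def)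

lemma matrix_inv:
  assumes "invertible A"
  shows matrix_inv_right: "A ** matrix_inv A = mat 1" and matrix_inv_left: "matrix_inv A ** A = mat 1"
  using someI_ex[OF assms[unfolded invertible_def]] by (auto simp: matrix_inv_def)

lemma change_coords_inverse [simp]:
  assumes "invertible A"
  shows "change_coords A (change_coords (matrix_inv A) p) = p"
    "change_coords (matrix_inv A) (change_coords A p) = p"
  by (simp_all add: change_coords_change_coords matrix_inv_left matrix_inv_right assms)

lemma invertible_matrix_inv: "invertible A \<Longrightarrow> invertible (matrix_inv (A::'a::field^'n^'n))"
  by (metis invertible_def matrix_inv_left matrix_inv_right)

lemma inj_change_coords: "invertible A \<Longrightarrow> inj (change_coords A)"
  by (metis injI change_coords_inverse(2))

lemma inj_matrix: "invertible A \<Longrightarrow> inj ((*v) (A::'a::field^'n^'n))"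
  by (metis inj_matrix_vector_mult)

lemma change_coords_subset_iff:
  "invertible A \<Longrightarrow> change_coords A p \<subseteq> change_coords A l \<longleftrightarrow> p \<subseteq> l"
  by (simp add: change_coords_def inj_image_subset_iff inj_matrix)

lemma change_coords_span: "change_coords A (vec.span S) = vec.span ((*v) A ` S)"
  by (simp add: change_coords_def vec.linear_span_image[OF matrix_vector_mul_linear_gen])

lemma dim_change_coords: "invertible A \<Longrightarrow> vec.dim (change_coords A S) = vec.dim S"
  unfolding change_coords_def
  by (rule vec.dim_image_eq[OF matrix_vector_mul_linear_gen])
    (meson inj_matrix inj_on_subset subset_UNIV)

lemma subspace_change_coords: "vec.subspace S \<Longrightarrow> vec.subspace (change_coords A S)"
  by (simp add: change_coords_def vec.subspace_image)

lemma change_coords_pg_points: "invertible A \<Longrightarrow> p \<in> pg_points \<Longrightarrow> change_coords A p \<in> pg_points"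
  by (simp add: pg_points_def dim_change_coords subspace_change_coords)

lemma change_coords_pg_lines: "invertible A \<Longrightarrow> l \<in> pg_lines \<Longrightarrow> change_coords A l \<in> pg_lines"
  by (simp add: pg_lines_def dim_change_coords subspace_change_coords)

lemma points_on_change_coords:
  assumes "invertible A"
  shows "points_on (change_coords A ` M) l = change_coords A ` points_on M (change_coords (matrix_inv A) l)"
proof -
  have "change_coords A p \<subseteq> l \<longleftrightarrow> p \<subseteq> change_coords (matrix_inv A) l" for p
    by (metis assms change_coords_inverse(1) change_coords_subset_iff)
  then show ?thesis by (auto simp: points_on_def)
qed

text \<open>An invertible matrix permutes the points and the lines and preserves incidence, so line
  intersection numbers carry over.\<close>

lemma maximal_arc_change_coords:
  fixes A :: "'a::{field,finite}^3^3"
  assumes A: "invertible A" and M: "maximal_arc d M"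
  shows "maximal_arc d (change_coords A ` M)"
proof -
  have "change_coords A ` M \<subseteq> pg_points"
    using M change_coords_pg_points[OF A] by (auto simp: maximal_arc_def)
  moreover have "change_coords A ` M \<noteq> pg_points"
  proof
    assume e: "change_coords A ` M = pg_points"
    have "p \<in> M" if "p \<in> pg_points" for p
    proof -
      have "change_coords A p \<in> change_coords A ` M"
        using e that change_coords_pg_points[OF A] by blast
      then show ?thesis by (simp add: inj_image_mem_iff inj_change_coords[OF A])
    qed
    then show False using M by (auto simp: maximal_arc_def)
  qed
  moreover have "card (points_on (change_coords A ` M) l) \<in> {0, d}" if "l \<in> pg_lines" for l
  proof -
    have "card (points_on (change_coords A ` M) l) = card (points_on M (change_coords (matrix_inv A) l))"
      unfolding points_on_change_coords[OF A]
      by (rule card_image) (use inj_change_coords[OF A] inj_on_subset in blast)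
    moreover have "change_coords (matrix_inv A) l \<in> pg_lines"
      using that A by (simp add: change_coords_pg_lines invertible_matrix_inv)
    ultimately show ?thesis using M by (simp add: maximal_arc_def)
  qed
  ultimately show ?thesis using M by (auto simp: maximal_arc_def)
qed

lemma mathon_type_change_coords:
  fixes A :: "'a::{field,finite}^3^3"
  assumes A: "invertible A" and M: "mathon_type M"
  shows "mathon_type (change_coords A ` M)"
proof -
  obtain B P where B: "invertible B" "P \<noteq> {}" "closed_mathon_set P"
      "M = change_coords B ` mathon_point_set P"
    using M by (auto simp: mathon_type_def)
  have "change_coords A ` M = change_coords (A ** B) ` mathon_point_set P"
    by (simp add: B(4) image_image change_coords_change_coords)
  moreover have "invertible (A ** B)" using A B(1) by (rule invertible_mult)
  ultimately show ?thesis using B(2,3) unfolding mathon_type_def by blast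
qed

text \<open>The vector x is completed to a basis by two of the three unit vectors. The determinants
  of the three candidates are, up to sign, the coordinates of x.\<close>

lemma ex_matrix_third_column:
  fixes x :: "'a::field^3"
  assumes "x \<noteq> 0"
  obtains A where "invertible A" "A *v (vector [0, 0, 1] :: 'a^3) = x"
proof -
  define A1 where "A1 = (vector [vector [1, 0, x $ 1], vector [0, 1, x $ 2], vector [0, 0, x $ 3]] :: 'a^3^3)"
  define A2 where "A2 = (vector [vector [1, 0, x $ 1], vector [0, 0, x $ 2], vector [0, 1, x $ 3]] :: 'a^3^3)"
  define A3 where "A3 = (vector [vector [0, 0, x $ 1], vector [1, 0, x $ 2], vector [0, 1, x $ 3]] :: 'a^3^3)"
  have "det A1 = x $ 3" "det A2 = - x $ 2" "det A3 = x $ 1"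
    by (simp_all add: det_3 A1_def A2_def A3_def)
  moreover have "x $ 1 \<noteq> 0 \<or> x $ 2 \<noteq> 0 \<or> x $ 3 \<noteq> 0"
    using assms by (auto simp: vec3_eq_iff)
  ultimately have "invertible A1 \<or> invertible A2 \<or> invertible A3"
    by (auto simp: invertible_det_nz)
  moreover have "A *v (vector [0, 0, 1] :: 'a^3) = x" if "A = A1 \<or> A = A2 \<or> A = A3" for A
    using that by (auto simp: vec3_eq_iff matrix_vector_mult_def sum_3 A1_def A2_def A3_def)
  ultimately show ?thesis using that by blast
qed

lemma F0_pg_point: "F0 \<in> pg_points"
  unfolding F0_def by (rule pg_points_spanI) (simp add: vector3_eq_0_iff)

lemma ex_change_coords_F0:
  fixes p :: "('a::field^3) set"
  assumes "p \<in> pg_points"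
  obtains A where "invertible A" "change_coords A F0 = p"
proof -
  obtain v where v: "v \<noteq> 0" "p = vec.span {v}" using assms by (auto simp: pg_points_iff)
  obtain A where "invertible A" "A *v (vector [0, 0, 1] :: 'a^3) = v"
    using ex_matrix_third_column[OF v(1)] by metis
  then show ?thesis using that[of A] v(2) by (simp add: F0_def change_coords_span)
qed

section \<open>Counting along the lines through a point\<close>

definition lines_through :: "('a::field^3) set \<Rightarrow> ('a^3) set set" where
  "lines_through p = {l \<in> pg_lines. p \<subseteq> l}"

text \<open>A change of coordinates moving \<open>F0\<close> to p carries one pencil onto the other.
  Counts from two different points can therefore be compared.\<close>

lemma card_lines_through:
  fixes p :: "('a::{field,finite}^3) set"
  assumes "p \<in> pg_points"
  shows "card (lines_through p) = card (lines_through (F0 :: ('a^3) set))"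
proof -
  obtain A where A: "invertible A" "change_coords A F0 = p"
    using ex_change_coords_F0[OF assms] by metis
  have "lines_through p = change_coords A ` lines_through F0"
  proof (intro equalityI subsetI)
    fix l assume l: "l \<in> lines_through p"
    have "F0 = change_coords (matrix_inv A) p" using A by auto
    moreover have "change_coords (matrix_inv A) p \<subseteq> change_coords (matrix_inv A) l"
      using l A(1) by (simp add: lines_through_def invertible_matrix_inv change_coords_subset_iff)
    ultimately have "change_coords (matrix_inv A) l \<in> lines_through F0"
      using l A(1) by (simp add: lines_through_def change_coords_pg_lines invertible_matrix_inv)
    then show "l \<in> change_coords A ` lines_through F0"
      by (metis A(1) change_coords_inverse(1) image_eqI)
  next
    fix l assume "l \<in> change_coords A ` lines_through F0"
    then obtain m where m: "m \<in> pg_lines" "F0 \<subseteq> m" "l = change_coords A m"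
      by (auto simp: lines_through_def)
    have "p \<subseteq> l" using m(2) by (simp only: m(3) A(2)[symmetric] change_coords_subset_iff[OF A(1)])
    then show "l \<in> lines_through p"
      using m A(1) by (simp add: lines_through_def change_coords_pg_lines)
  qed
  then show ?thesis
    by (simp add: card_image inj_on_subset[OF inj_change_coords[OF A(1)]])
qed

lemma two_le_card_lines_through_F0: "2 \<le> card (lines_through (F0 :: ('a::{field,finite}^3) set))"
proof -
  let ?l1 = "proj_line 1 0 0 :: ('a^3) set" and ?l2 = "proj_line 0 1 0 :: ('a^3) set"
  have F: "F0 \<subseteq> proj_line a b 0" for a b :: 'a
    unfolding F0_def by (subst span_subset_iff) (simp_all add: subspace_proj_line, simp add: proj_line_def)
  have "{?l1, ?l2} \<subseteq> lines_through F0"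
    using F by (auto simp: lines_through_def proj_line_in_pg_lines)
  then have "card {?l1, ?l2} \<le> card (lines_through (F0 :: ('a^3) set))"
    by (rule card_mono[rotated]) simp
  moreover have "vector [0, 1, 0] \<in> ?l1" "vector [0, 1, 0] \<notin> ?l2"
    by (auto simp: proj_line_def)
  then have "?l1 \<noteq> ?l2" by metis
  ultimately show ?thesis by simp
qed

text \<open>Every point other than p lies on exactly one line through p, so the lines through p
  partition S.\<close>

lemma card_eq_sum_lines_through:
  fixes S :: "('a::{field,finite}^3) set set"
  assumes "p \<in> pg_points" "S \<subseteq> pg_points - {p}"
  shows "card S = (\<Sum>l\<in>lines_through p. card (points_on S l))"
proof -
  have ex1: "\<exists>!l. l \<in> lines_through p \<and> x \<subseteq> l" if "x \<in> S" for x
    using ex1_line_through[of p x] assms that unfolding lines_through_def by blast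
  have "S = (\<Union>l\<in>lines_through p. points_on S l)"
    using ex1 by (auto simp: points_on_def) metis
  also have "card \<dots> = (\<Sum>l\<in>lines_through p. card (points_on S l))"
  proof (intro card_UN_disjoint ballI impI)
    fix l l' assume "l \<in> lines_through p" "l' \<in> lines_through p" "l \<noteq> l'"
    then show "points_on S l \<inter> points_on S l' = {}"
      using ex1 by (auto simp: points_on_def)
  qed auto
  finally show ?thesis .
qed

text \<open>Otherwise, counting the points of \<open>M\<close> from \<open>X\<close> and from \<open>n\<close> gives
  \<open>N D = N (D - 1) + 1\<close>, where \<open>N \<ge> 2\<close> is the number of lines through a point.\<close>

lemma ex_external_line:
  fixes M :: "('a::{field,finite}^3) set set"
  assumes M: "M \<subseteq> pg_points" "\<And>l. l \<in> pg_lines \<Longrightarrow> card (points_on M l) \<in> {0, D}"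
    and n: "n \<in> M" and X: "X \<in> pg_points" "X \<notin> M"
  shows "\<exists>l\<in>pg_lines. X \<subseteq> l \<and> points_on M l = {}"
proof (rule ccontr)
  assume ext: "\<not> (\<exists>l\<in>pg_lines. X \<subseteq> l \<and> points_on M l = {})"
  have ne: "points_on M l \<noteq> {}" if "l \<in> lines_through X" for l
    using that ext unfolding lines_through_def by blast
  define N where "N = card (lines_through (F0 :: ('a^3) set))"
  have N: "2 \<le> N" unfolding N_def by (rule two_le_card_lines_through_F0)
  have "card M = (\<Sum>l\<in>lines_through X. card (points_on M l))"
    using M X by (intro card_eq_sum_lines_through) auto
  also have "\<dots> = (\<Sum>l\<in>lines_through X. D)"
    using M(2) ne by (intro sum.cong) (fastforce simp: lines_through_def)+
  also have "\<dots> = N * D" using X by (simp add: card_lines_through N_def)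
  finally have 1: "card M = N * D" .
  have Dl: "card (points_on M l) = D" "n \<in> points_on M l" if "l \<in> lines_through n" for l
  proof -
    show "n \<in> points_on M l" using that n by (auto simp: lines_through_def points_on_def)
    then show "card (points_on M l) = D"
      using M(2)[of l] that by (auto simp: lines_through_def)
  qed
  have "card (M - {n}) = (\<Sum>l\<in>lines_through n. card (points_on (M - {n}) l))"
    using M n by (intro card_eq_sum_lines_through) auto
  also have "\<dots> = (\<Sum>l\<in>lines_through n. D - 1)"
  proof (intro sum.cong refl)
    fix l assume "l \<in> lines_through n"
    moreover have "points_on (M - {n}) l = points_on M l - {n}" by (auto simp: points_on_def)
    ultimately show "card (points_on (M - {n}) l) = D - 1" by (simp add: Dl)
  qed
  also have "\<dots> = N * (D - 1)" using n M(1) by (simp add: card_lines_through N_def subsetD)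
  finally have 2: "card M - 1 = N * (D - 1)" using n by simp
  have "card M > 0" using n by (auto simp: card_gt_0_iff)
  \<comment> \<open>Positivity turns the truncated differences into true ones: with
    \<open>D = Suc e\<close> the two counts give N e + N - 1 = N e, contrary to N \<ge> 2.\<close>
  then have "D > 0" using 1 by (auto intro: gr0I)
  then obtain e where "D = Suc e" by (cases D) auto
  then show False using 1 2 N by simp
qed

section \<open>Conics and lines\<close>

context even_order_field
begin

definition conic_form :: "'a mathon_param \<Rightarrow> 'a^3 \<Rightarrow> 'a" where
  "conic_form = (\<lambda>(\<alpha>, \<beta>, \<mu>) v. \<alpha> * (v $ 1)\<^sup>2 + v $ 1 * v $ 2 + \<beta> * (v $ 2)\<^sup>2 + \<mu> * (v $ 3)\<^sup>2)"

lemma conic_form_scale: "conic_form w (k *s v) = k\<^sup>2 * conic_form w v"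
  by (cases w) (simp add: conic_form_def algebra_simps power2_eq_square)

lemma span_in_mathon_conic_iff:
  "v \<noteq> 0 \<Longrightarrow> vec.span {v} \<in> mathon_conic w \<longleftrightarrow> conic_form w v = 0"
proof -
  assume v: "v \<noteq> 0"
  have "vec.span {v} \<in> mathon_conic w \<longleftrightarrow> (\<forall>u\<in>vec.span {v}. conic_form w u = 0)"
    using pg_points_spanI[OF v] by (cases w) (simp add: mathon_conic_def conic_form_def)
  also have "\<dots> \<longleftrightarrow> conic_form w v = 0"
    by (auto simp: vec.span_singleton conic_form_scale dest: spec[of _ 1])
  finally show ?thesis .
qed

lemma mathon_conicE:
  assumes "p \<in> mathon_conic w"
  obtains v where "v \<noteq> 0" "p = vec.span {v}" "conic_form w v = 0"
proof -
  have "p \<in> pg_points" using assms by (cases w) (simp add: mathon_conic_def)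
  then show ?thesis using that assms span_in_mathon_conic_iff by (metis pg_points_iff)
qed

lemma mathon_conic_pg_points: "mathon_conic w \<subseteq> pg_points"
  by (auto simp: mathon_conic_def)

lemma F0_not_in_mathon_conic: "(\<mu>::'a) \<noteq> 0 \<Longrightarrow> F0 \<notin> mathon_conic (\<alpha>, \<beta>, \<mu>)"
  unfolding F0_def
  by (subst span_in_mathon_conic_iff; simp add: vector3_eq_0_iff conic_form_def)

lemma span_subset_proj_line: "vec.span {v} \<subseteq> proj_line a b c \<longleftrightarrow> a * v $ 1 + b * v $ 2 + c * v $ 3 = 0"
  by (simp add: span_subset_iff subspace_proj_line) (simp add: proj_line_def)

lemma F0_subset_proj_line: "F0 \<subseteq> proj_line a b c \<longleftrightarrow> c = 0"
  by (simp add: F0_def span_subset_proj_line)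

text \<open>A line off \<open>F0\<close> has a nonzero third coordinate, normalised here to 1; in
  characteristic 2 its equation then reads z = r x + s y.\<close>

lemma pg_line_cases:
  fixes l :: "('a^3) set"
  assumes "l \<in> pg_lines"
  obtains (through_F0) a b where "(a, b) \<noteq> (0, 0)" "l = proj_line a b 0"
    | (off_F0) r s where "l = proj_line r s 1"
proof -
  obtain a b c where l: "(a, b, c) \<noteq> (0, 0, 0)" "l = proj_line a b c"
    using assms by (rule pg_lineE)
  show ?thesis
  proof (cases "c = 0")
    case False
    have "a / c * x + b / c * y + z = (a * x + b * y + c * z) / c" for x y z
      using False by (simp add: field_simps)
    then have "l = proj_line (a / c) (b / c) 1"
      using l False by (simp add: proj_line_def)
    then show ?thesis by (rule off_F0)
  qed (use l through_F0 in auto)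
qed

text \<open>On the line a x + b y = 0 through \<open>F0\<close>, the pair (x, y) is proportional to
  (b, a), and the equation of the conic determines z^2, hence z.\<close>

definition conic_point :: "'a \<Rightarrow> 'a \<Rightarrow> 'a mathon_param \<Rightarrow> ('a^3) set" where
  "conic_point a b = (\<lambda>(\<alpha>, \<beta>, \<mu>).
     vec.span {vector [b, a, sqroot ((\<alpha> * b\<^sup>2 + a * b + \<beta> * a\<^sup>2) / \<mu>)]})"

text \<open>Square roots exist and are unique, so every line through \<open>F0\<close> meets the
  conic exactly once: \<open>F0\<close> is the nucleus.\<close>

lemma points_on_conic_through_F0:
  assumes ab: "(a, b) \<noteq> (0, 0)" and mu: "\<mu> \<noteq> 0"
  shows "points_on (mathon_conic (\<alpha>, \<beta>, \<mu>)) (proj_line a b 0) = {conic_point a b (\<alpha>, \<beta>, \<mu>)}"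
proof -
  define z where "z = sqroot ((\<alpha> * b\<^sup>2 + a * b + \<beta> * a\<^sup>2) / \<mu>)"
  have z: "\<mu> * z\<^sup>2 = \<alpha> * b\<^sup>2 + a * b + \<beta> * a\<^sup>2" using mu by (simp add: z_def)
  let ?P = "vec.span {vector [b, a, z] :: 'a^3}"
  have nz: "(vector [b, a, z] :: 'a^3) \<noteq> 0" using ab by (auto simp: vector3_eq_0_iff)
  have "?P \<in> mathon_conic (\<alpha>, \<beta>, \<mu>)"
    using nz by (simp add: span_in_mathon_conic_iff conic_form_def z algebra_simps)
  moreover have "?P \<subseteq> proj_line a b 0"
    by (simp add: span_subset_proj_line mult.commute)
  moreover have "p = ?P" if p: "p \<in> mathon_conic (\<alpha>, \<beta>, \<mu>)" "p \<subseteq> proj_line a b 0" for p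
  proof -
    obtain v where v: "v \<noteq> 0" "p = vec.span {v}" "conic_form (\<alpha>, \<beta>, \<mu>) v = 0"
      using p(1) by (rule mathon_conicE)
    have "a * v $ 1 + b * v $ 2 = 0" using p(2) v(2) by (simp add: span_subset_proj_line)
    then have e: "a * v $ 1 = b * v $ 2" by (simp add: add_eq_0_iff_eq)
    obtain c where c: "v $ 1 = c * b" "v $ 2 = c * a"
    proof (cases "a = 0")
      case True
      then show ?thesis using that[of "v $ 1 / b"] ab e by auto
    next
      case False
      then show ?thesis using that[of "v $ 2 / a"] e by (simp add: field_simps)
    qed
    have "\<mu> * (v $ 3)\<^sup>2 = \<alpha> * (v $ 1)\<^sup>2 + v $ 1 * v $ 2 + \<beta> * (v $ 2)\<^sup>2"
      using v(3) by (simp add: conic_form_def add_eq_0_iff_eq)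
    also have "\<dots> = c\<^sup>2 * (\<mu> * z\<^sup>2)"
      unfolding c z by (simp add: algebra_simps power2_eq_square)
    finally have "(v $ 3)\<^sup>2 = (c * z)\<^sup>2"
      using mu by (simp add: power_mult_distrib mult.left_commute)
    then have "v $ 3 = c * z" by (simp add: square_eq_iff_eq)
    then have "v = c *s vector [b, a, z]" using c by (simp add: vec3_eq_iff)
    then have "v \<in> ?P" by (auto simp: vec.span_singleton)
    then show ?thesis unfolding v(2) using v(1) by (rule span_singleton_eqI)
  qed
  ultimately show ?thesis
    unfolding points_on_def conic_point_def z_def[symmetric] split by blast
qed

text \<open>The line \<open>z = r x + s y\<close> is external to the conic if this trace is 1, and meets the conic
  in two points otherwise.\<close>

definition line_trace :: "'a \<Rightarrow> 'a \<Rightarrow> 'a mathon_param \<Rightarrow> 'a" where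
  "line_trace r s = (\<lambda>(\<alpha>, \<beta>, \<mu>). abs_trace ((\<alpha> + \<mu> * r\<^sup>2) * (\<beta> + \<mu> * s\<^sup>2)))"

lemma line_trace_cases: "line_trace r s w = 0 \<or> line_trace r s w = 1"
  by (cases w) (simp add: line_trace_def abs_trace_cases)

lemma conic_form_on_line:
  assumes "v $ 3 = r * v $ 1 + s * v $ 2"
  shows "conic_form (\<alpha>, \<beta>, \<mu>) v =
    (\<alpha> + \<mu> * r\<^sup>2) * (v $ 1)\<^sup>2 + v $ 1 * v $ 2 + (\<beta> + \<mu> * s\<^sup>2) * (v $ 2)\<^sup>2"
  unfolding conic_form_def split assms add_square by (simp add: algebra_simps power2_eq_square)

lemma span_subset_proj_line_1:
  "vec.span {v} \<subseteq> proj_line r s 1 \<longleftrightarrow> v $ 3 = r * v $ 1 + (s::'a) * v $ 2"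
  by (auto simp: span_subset_proj_line add_eq_0_iff_eq)

text \<open>Substituting z = r x + s y into the equation leaves a binary form in x and y; the line
  is external iff this form has no nontrivial zero.\<close>

lemma points_on_conic_off_F0_empty_iff:
  "points_on (mathon_conic w) (proj_line r s 1) = {} \<longleftrightarrow> line_trace r s w = 1"
proof -
  obtain \<alpha> \<beta> \<mu> where w: "w = (\<alpha>, \<beta>, \<mu>)" by (cases w) auto
  let ?a = "\<alpha> + \<mu> * r\<^sup>2" and ?b = "\<beta> + \<mu> * s\<^sup>2"
  have "points_on (mathon_conic w) (proj_line r s 1) \<noteq> {} \<longleftrightarrow>
      (\<exists>x y. (x, y) \<noteq> (0, 0) \<and> ?a * x\<^sup>2 + x * y + ?b * y\<^sup>2 = 0)"
  proof
    assume "points_on (mathon_conic w) (proj_line r s 1) \<noteq> {}"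
    then obtain p where p: "p \<in> mathon_conic w" "p \<subseteq> proj_line r s 1"
      by (auto simp: points_on_def)
    obtain v where v: "v \<noteq> 0" "p = vec.span {v}" "conic_form w v = 0"
      using p(1) by (rule mathon_conicE)
    have v3: "v $ 3 = r * v $ 1 + s * v $ 2" using p(2) v(2) span_subset_proj_line_1 by blast
    then have "(v $ 1, v $ 2) \<noteq> (0, 0)" using v(1) by (auto simp: vec3_eq_iff)
    then show "\<exists>x y. (x, y) \<noteq> (0, 0) \<and> ?a * x\<^sup>2 + x * y + ?b * y\<^sup>2 = 0"
      using v(3) conic_form_on_line[OF v3] w by metis
  next
    assume "\<exists>x y. (x, y) \<noteq> (0, 0) \<and> ?a * x\<^sup>2 + x * y + ?b * y\<^sup>2 = 0"
    then obtain x y where xy: "(x, y) \<noteq> (0, 0)" "?a * x\<^sup>2 + x * y + ?b * y\<^sup>2 = 0" by blast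
    let ?v = "vector [x, y, r * x + s * y] :: 'a^3"
    have "?v \<noteq> 0" using xy by (auto simp: vector3_eq_0_iff)
    moreover have "conic_form w ?v = 0"
      unfolding w by (subst conic_form_on_line) (use xy in simp_all)
    moreover have "vec.span {?v} \<subseteq> proj_line r s 1" by (simp add: span_subset_proj_line_1)
    ultimately have "vec.span {?v} \<in> points_on (mathon_conic w) (proj_line r s 1)"
      by (simp add: points_on_def span_in_mathon_conic_iff)
    then show "points_on (mathon_conic w) (proj_line r s 1) \<noteq> {}" by blast
  qed
  then show ?thesis
    unfolding binary_form_isotropic_iff using line_trace_cases[of r s w] by (auto simp: w line_trace_def)
qed

lemma card_points_on_conic_off_F0:
  assumes "line_trace r s w = 0"
  shows "card (points_on (mathon_conic w) (proj_line r s 1)) = 2"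
proof -
  obtain \<alpha> \<beta> \<mu> where w: "w = (\<alpha>, \<beta>, \<mu>)" by (cases w) auto
  let ?a = "\<alpha> + \<mu> * r\<^sup>2" and ?b = "\<beta> + \<mu> * s\<^sup>2"
  obtain x y where xy: "(x, y) \<noteq> (0, 0)" "?a * x\<^sup>2 + x * y + ?b * y\<^sup>2 = 0"
    using assms binary_form_isotropic_iff[of ?a ?b] by (auto simp: w line_trace_def)
  obtain m k where mk: "\<And>s t. ?a * s\<^sup>2 + s * t + ?b * t\<^sup>2 = (y * s + x * t) * (m * s + k * t)"
      "x * m + y * k = 1"
    using binary_form_factor[OF xy(2,1)] by blast
  \<comment> \<open>The zeros of the two linear factors, lifted to the line. They span different
    points because \<open>x * m + y * k\<close> is the determinant of (x, y) and (k, m).\<close>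
  let ?u = "vector [x, y, r * x + s * y] :: 'a^3" and ?v = "vector [k, m, r * k + s * m] :: 'a^3"
  have nz: "?u \<noteq> 0" "?v \<noteq> 0" using mk(2) by (auto simp: vector3_eq_0_iff)
  have "conic_form w ?u = 0" "conic_form w ?v = 0"
    unfolding w
    by (subst conic_form_on_line[of _ r s]; (simp only: mk(1))?; simp add: mult.commute)+
  then have "{vec.span {?u}, vec.span {?v}} \<subseteq> points_on (mathon_conic w) (proj_line r s 1)"
    using nz by (simp add: points_on_def span_in_mathon_conic_iff span_subset_proj_line_1)
  moreover have "p \<in> {vec.span {?u}, vec.span {?v}}"
    if p: "p \<in> mathon_conic w" "p \<subseteq> proj_line r s 1" for p
  proof -
    obtain v where v: "v \<noteq> 0" "p = vec.span {v}" "conic_form w v = 0"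
      using p(1) by (rule mathon_conicE)
    have v3: "v $ 3 = r * v $ 1 + s * v $ 2" using p(2) v(2) span_subset_proj_line_1 by blast
    have "(y * v $ 1 + x * v $ 2) * (m * v $ 1 + k * v $ 2) = 0"
      using v(3) unfolding w conic_form_on_line[OF v3] mk(1) .
    then consider "y * v $ 1 = x * v $ 2" | "m * v $ 1 = k * v $ 2"
      by (auto simp: add_eq_0_iff_eq)
    then show ?thesis
    proof cases
      case 1
      \<comment> \<open>When one factor vanishes at \<open>v\<close>, the value of the other one is
        the scalar relating \<open>v\<close> to the zero of the first; this uses
        \<open>x * m + y * k = 1\<close>.\<close>
      let ?c = "m * v $ 1 + k * v $ 2"
      have "?c * x = (x * m) * v $ 1 + k * (x * v $ 2)" by (simp add: algebra_simps)
      also have "\<dots> = (x * m + y * k) * v $ 1" by (simp add: algebra_simps flip: 1)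
      finally have c1: "v $ 1 = ?c * x" by (simp add: mk(2))
      have "?c * y = m * (y * v $ 1) + (y * k) * v $ 2" by (simp add: algebra_simps)
      also have "\<dots> = (x * m + y * k) * v $ 2" by (simp add: algebra_simps 1)
      finally have c2: "v $ 2 = ?c * y" by (simp add: mk(2))
      obtain c where "v $ 1 = c * x" "v $ 2 = c * y" using c1 c2 by blast
      then have "v = c *s ?u" using v3 by (simp add: vec3_eq_iff algebra_simps)
      then have "v \<in> vec.span {?u}" unfolding vec.span_singleton by (rule range_eqI)
      then show ?thesis using span_singleton_eqI v(1,2) by blast
    next
      case 2
      let ?c = "y * v $ 1 + x * v $ 2"
      have "?c * k = (y * k) * v $ 1 + x * (k * v $ 2)" by (simp add: algebra_simps)
      also have "\<dots> = (x * m + y * k) * v $ 1" by (simp add: algebra_simps flip: 2)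
      finally have c1: "v $ 1 = ?c * k" by (simp add: mk(2))
      have "?c * m = y * (m * v $ 1) + (x * m) * v $ 2" by (simp add: algebra_simps)
      also have "\<dots> = (x * m + y * k) * v $ 2" by (simp add: algebra_simps 2)
      finally have c2: "v $ 2 = ?c * m" by (simp add: mk(2))
      obtain c where "v $ 1 = c * k" "v $ 2 = c * m" using c1 c2 by blast
      then have "v = c *s ?v" using v3 by (simp add: vec3_eq_iff algebra_simps)
      then have "v \<in> vec.span {?v}" unfolding vec.span_singleton by (rule range_eqI)
      then show ?thesis using span_singleton_eqI v(1,2) by blast
    qed
  qed
  ultimately have "points_on (mathon_conic w) (proj_line r s 1) = {vec.span {?u}, vec.span {?v}}"
    by (auto simp: points_on_def)
  moreover have "vec.span {?u} \<noteq> vec.span {?v}"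
  proof
    assume "vec.span {?u} = vec.span {?v}"
    then have "?u \<in> vec.span {?v}" by (metis insertI1 vec.span_base)
    then obtain c where "?u = c *s ?v" by (auto simp: vec.span_singleton)
    then have "x = c * k" "y = c * m" by (simp_all add: vec3_eq_iff)
    then have "x * m + y * k = 0" by (simp add: mult.commute mult.left_commute)
    then show False using mk(2) by simp
  qed
  ultimately show ?thesis by simp
qed

lemma card_points_on_conic_le:
  fixes \<alpha> \<beta> \<mu> :: 'a
  assumes "\<mu> \<noteq> 0" "l \<in> pg_lines"
  shows "card (points_on (mathon_conic (\<alpha>, \<beta>, \<mu>)) l) \<le> 2"
  using assms(2)
proof (cases rule: pg_line_cases)
  case (off_F0 r s)
  then show ?thesis
    using card_points_on_conic_off_F0[of r s "(\<alpha>, \<beta>, \<mu>)"] line_trace_cases[of r s "(\<alpha>, \<beta>, \<mu>)"]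
      points_on_conic_off_F0_empty_iff[of "(\<alpha>, \<beta>, \<mu>)" r s]
    by (metis card.empty order.refl zero_le)
qed (simp add: points_on_conic_through_F0 assms(1))

section \<open>Pairs of conics: composition, disjointness, common points\<close>

text \<open>Eliminating z^2 from the two equations leaves a binary form whose xy-coefficient is
  \<mu> + \<mu>'. After division by it, this is the trace that decides whether the form has a
  nontrivial zero.\<close>

definition pair_trace :: "'a mathon_param \<Rightarrow> 'a mathon_param \<Rightarrow> 'a" where
  "pair_trace = (\<lambda>(\<alpha>, \<beta>, \<mu>) (\<alpha>', \<beta>', \<mu>').
     abs_trace ((\<alpha> * \<mu>' + \<mu> * \<alpha>') * (\<beta> * \<mu>' + \<mu> * \<beta>') / (\<mu> + \<mu>')\<^sup>2))"

text \<open>The deviation from additivity is the same for all lines: in the cross terms A \<mu>' +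
  \<mu> A' and B \<mu>' + \<mu> B' the contributions of r and s cancel.\<close>

lemma line_trace_compose:
  assumes "\<mu> \<noteq> \<mu>'"
  shows "line_trace r s (mathon_compose (\<alpha>, \<beta>, \<mu>) (\<alpha>', \<beta>', \<mu>')) =
    line_trace r s (\<alpha>, \<beta>, \<mu>) + line_trace r s (\<alpha>', \<beta>', \<mu>') +
    pair_trace (\<alpha>, \<beta>, \<mu>) (\<alpha>', \<beta>', \<mu>')"
proof -
  define A B A' B' where AB: "A = \<alpha> + \<mu> * r\<^sup>2" "B = \<beta> + \<mu> * s\<^sup>2" "A' = \<alpha>' + \<mu>' * r\<^sup>2" "B' = \<beta>' + \<mu>' * s\<^sup>2"
  have ne: "\<mu> + \<mu>' \<noteq> 0" using assms by (simp add: add_eq_0_iff_eq)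
  have shift: "(a * \<mu> + a' * \<mu>') / (\<mu> + \<mu>') + (\<mu> + \<mu>') * c =
      ((a + \<mu> * c) * \<mu> + (a' + \<mu>' * c) * \<mu>') / (\<mu> + \<mu>')" for a a' c
    using ne by (simp add: field_simps)
  have pair: "A * \<mu>' + \<mu> * A' = \<alpha> * \<mu>' + \<mu> * \<alpha>'" "B * \<mu>' + \<mu> * B' = \<beta> * \<mu>' + \<mu> * \<beta>'"
    by (simp_all add: AB algebra_simps)
  \<comment> \<open>The polynomial identity behind the lemma, valid in characteristic 2; dividing by
    (\<mu> + \<mu>')^2 and taking traces gives the three summands.\<close>
  have "(A * \<mu> + A' * \<mu>') * (B * \<mu> + B' * \<mu>') =
      (A * B + A' * B') * (\<mu> + \<mu>')\<^sup>2 + (A * \<mu>' + \<mu> * A') * (B * \<mu>' + \<mu> * B')"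
    unfolding add_square by (simp add: algebra_simps power2_eq_square)
  then have "(A * \<mu> + A' * \<mu>') * (B * \<mu> + B' * \<mu>') / (\<mu> + \<mu>')\<^sup>2 =
      A * B + A' * B' + (A * \<mu>' + \<mu> * A') * (B * \<mu>' + \<mu> * B') / (\<mu> + \<mu>')\<^sup>2"
    using ne by (simp add: add_divide_distrib[of _ "(A * \<mu>' + \<mu> * A') * _"])
  then have "((A * \<mu> + A' * \<mu>') / (\<mu> + \<mu>')) * ((B * \<mu> + B' * \<mu>') / (\<mu> + \<mu>')) =
      A * B + A' * B' + (A * \<mu>' + \<mu> * A') * (B * \<mu>' + \<mu> * B') / (\<mu> + \<mu>')\<^sup>2"
    by (simp add: power2_eq_square)
  then show ?thesis
    unfolding line_trace_def pair_trace_def mathon_compose_def split shift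
    unfolding AB(1-4)[symmetric] pair by (simp add: abs_trace_add)
qed

text \<open>A common point gives a zero of the form \<open>elim\<close> obtained by eliminating z^2,
  and every nontrivial zero lifts to a common point by a square root. For \<mu> = \<mu>' the xy-term
  disappears, so that a nontrivial zero always exists.\<close>

lemma disjoint_conics_iff:
  assumes mu: "\<mu> \<noteq> 0" "\<mu>' \<noteq> 0"
  shows "mathon_conic (\<alpha>, \<beta>, \<mu>) \<inter> mathon_conic (\<alpha>', \<beta>', \<mu>') = {} \<longleftrightarrow>
    \<mu> \<noteq> \<mu>' \<and> pair_trace (\<alpha>, \<beta>, \<mu>) (\<alpha>', \<beta>', \<mu>') = 1"
proof -
  define elim where "elim x y =
    (\<alpha> * \<mu>' + \<mu> * \<alpha>') * x\<^sup>2 + (\<mu> + \<mu>') * (x * y) + (\<beta> * \<mu>' + \<mu> * \<beta>') * y\<^sup>2" for x y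
  have elim: "elim x y = \<mu>' * (\<alpha> * x\<^sup>2 + x * y + \<beta> * y\<^sup>2) + \<mu> * (\<alpha>' * x\<^sup>2 + x * y + \<beta>' * y\<^sup>2)" for x y
    by (simp add: elim_def algebra_simps)
  have "mathon_conic (\<alpha>, \<beta>, \<mu>) \<inter> mathon_conic (\<alpha>', \<beta>', \<mu>') \<noteq> {} \<longleftrightarrow>
      (\<exists>x y. (x, y) \<noteq> (0, 0) \<and> elim x y = 0)"
  proof
    assume "mathon_conic (\<alpha>, \<beta>, \<mu>) \<inter> mathon_conic (\<alpha>', \<beta>', \<mu>') \<noteq> {}"
    then obtain p where p: "p \<in> mathon_conic (\<alpha>, \<beta>, \<mu>)" "p \<in> mathon_conic (\<alpha>', \<beta>', \<mu>')" by blast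
    obtain v where v: "v \<noteq> 0" "p = vec.span {v}" "conic_form (\<alpha>, \<beta>, \<mu>) v = 0"
      using p(1) by (rule mathon_conicE)
    have v': "conic_form (\<alpha>', \<beta>', \<mu>') v = 0"
      using p(2) v(1,2) by (simp add: span_in_mathon_conic_iff)
    have "(v $ 1, v $ 2) \<noteq> (0, 0)"
      using v mu by (auto simp: vec3_eq_iff conic_form_def)
    moreover have "\<alpha> * (v $ 1)\<^sup>2 + v $ 1 * v $ 2 + \<beta> * (v $ 2)\<^sup>2 = \<mu> * (v $ 3)\<^sup>2"
        "\<alpha>' * (v $ 1)\<^sup>2 + v $ 1 * v $ 2 + \<beta>' * (v $ 2)\<^sup>2 = \<mu>' * (v $ 3)\<^sup>2"
      using v(3) v' by (simp_all add: conic_form_def add_eq_0_iff_eq)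
    then have "elim (v $ 1) (v $ 2) = 0" by (simp add: elim mult.left_commute)
    ultimately show "\<exists>x y. (x, y) \<noteq> (0, 0) \<and> elim x y = 0" by blast
  next
    assume "\<exists>x y. (x, y) \<noteq> (0, 0) \<and> elim x y = 0"
    then obtain x y where xy: "(x, y) \<noteq> (0, 0)" "elim x y = 0" by blast
    define z where "z = sqroot ((\<alpha> * x\<^sup>2 + x * y + \<beta> * y\<^sup>2) / \<mu>)"
    have z: "\<mu> * z\<^sup>2 = \<alpha> * x\<^sup>2 + x * y + \<beta> * y\<^sup>2" using mu by (simp add: z_def)
    have "\<mu> * (\<alpha>' * x\<^sup>2 + x * y + \<beta>' * y\<^sup>2) = \<mu> * (\<mu>' * z\<^sup>2)"
      using xy(2) unfolding elim z[symmetric] add_eq_0_iff_eq by (metis mult.left_commute)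
    then have z': "\<mu>' * z\<^sup>2 = \<alpha>' * x\<^sup>2 + x * y + \<beta>' * y\<^sup>2" using mu by simp
    have "(vector [x, y, z] :: 'a^3) \<noteq> 0" using xy(1) by (auto simp: vector3_eq_0_iff)
    then have "vec.span {vector [x, y, z] :: 'a^3} \<in> mathon_conic (\<alpha>, \<beta>, \<mu>)"
        "vec.span {vector [x, y, z] :: 'a^3} \<in> mathon_conic (\<alpha>', \<beta>', \<mu>')"
      using z z' by (simp_all add: span_in_mathon_conic_iff conic_form_def)
    then show "mathon_conic (\<alpha>, \<beta>, \<mu>) \<inter> mathon_conic (\<alpha>', \<beta>', \<mu>') \<noteq> {}" by blast
  qed
  also have "\<dots> \<longleftrightarrow> \<mu> = \<mu>' \<or> pair_trace (\<alpha>, \<beta>, \<mu>) (\<alpha>', \<beta>', \<mu>') = 0"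
  proof (cases "\<mu> = \<mu>'")
    case True
    have "\<exists>x y. (x, y) \<noteq> (0, 0) \<and> elim x y = 0"
    proof (cases "\<alpha> * \<mu>' + \<mu> * \<alpha>' = 0")
      case True
      then show ?thesis by (intro exI[of _ 1] exI[of _ 0]) (simp add: elim_def)
    next
      case False
      \<comment> \<open>The form is now a x^2 + b y^2, which vanishes when x^2 = b and y^2 =
        a.\<close>
      then have "elim (sqroot (\<beta> * \<mu>' + \<mu> * \<beta>')) (sqroot (\<alpha> * \<mu>' + \<mu> * \<alpha>')) = 0"
        by (simp add: elim_def \<open>\<mu> = \<mu>'\<close> mult.commute)
      moreover have "sqroot (\<alpha> * \<mu>' + \<mu> * \<alpha>') \<noteq> 0"
        using False by (metis sqroot_square zero_power2)
      ultimately show ?thesis by blast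
    qed
    then show ?thesis using True by simp
  next
    case False
    then have ne: "\<mu> + \<mu>' \<noteq> 0" by (simp add: add_eq_0_iff_eq)
    let ?a = "(\<alpha> * \<mu>' + \<mu> * \<alpha>') / (\<mu> + \<mu>')" and ?b = "(\<beta> * \<mu>' + \<mu> * \<beta>') / (\<mu> + \<mu>')"
    have "elim x y = (\<mu> + \<mu>') * (?a * x\<^sup>2 + x * y + ?b * y\<^sup>2)" for x y
      using ne by (simp add: elim_def distrib_left)
    then have "elim x y = 0 \<longleftrightarrow> ?a * x\<^sup>2 + x * y + ?b * y\<^sup>2 = 0" for x y
      using ne by simp
    then show ?thesis
      using False binary_form_isotropic_iff[of ?a ?b] by (simp add: pair_trace_def power2_eq_square)
  qed
  finally have "mathon_conic (\<alpha>, \<beta>, \<mu>) \<inter> mathon_conic (\<alpha>', \<beta>', \<mu>') \<noteq> {} \<longleftrightarrow>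
    \<mu> = \<mu>' \<or> pair_trace (\<alpha>, \<beta>, \<mu>) (\<alpha>', \<beta>', \<mu>') = 0" .
  moreover have "pair_trace (\<alpha>, \<beta>, \<mu>) (\<alpha>', \<beta>', \<mu>') \<in> {0, 1}"
    by (simp add: pair_trace_def abs_trace_cases)
  ultimately show ?thesis by auto
qed

text \<open>The sum of the two equations has no xy-term and is the square of a linear form. Common
  points therefore lie on one line, which meets the first conic in at most two points.\<close>

lemma card_inter_conics_le:
  fixes \<alpha> \<beta> \<mu> :: 'a
  assumes "\<mu> \<noteq> 0" "(\<alpha>, \<beta>, \<mu>) \<noteq> (\<alpha>', \<beta>', \<mu>')"
  shows "card (mathon_conic (\<alpha>, \<beta>, \<mu>) \<inter> mathon_conic (\<alpha>', \<beta>', \<mu>')) \<le> 2"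
proof -
  let ?l = "proj_line (sqroot (\<alpha> + \<alpha>')) (sqroot (\<beta> + \<beta>')) (sqroot (\<mu> + \<mu>'))"
  have sq: "sqroot x = 0 \<longleftrightarrow> x = 0" for x
    by (metis sqroot_square zero_power2 power_eq_0_iff)
  have l: "?l \<in> pg_lines"
    by (rule proj_line_in_pg_lines) (use assms(2) in \<open>auto simp: sq add_eq_0_iff_eq\<close>)
  have "mathon_conic (\<alpha>, \<beta>, \<mu>) \<inter> mathon_conic (\<alpha>', \<beta>', \<mu>') \<subseteq> points_on (mathon_conic (\<alpha>, \<beta>, \<mu>)) ?l"
  proof
    fix p assume p: "p \<in> mathon_conic (\<alpha>, \<beta>, \<mu>) \<inter> mathon_conic (\<alpha>', \<beta>', \<mu>')"
    then obtain v where v: "v \<noteq> 0" "p = vec.span {v}" "conic_form (\<alpha>, \<beta>, \<mu>) v = 0"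
      by (blast elim: mathon_conicE)
    have "conic_form (\<alpha>', \<beta>', \<mu>') v = 0"
      using p v(1,2) by (simp add: span_in_mathon_conic_iff)
    then have "conic_form (\<alpha>, \<beta>, \<mu>) v + conic_form (\<alpha>', \<beta>', \<mu>') v = 0" using v by simp
    also have "conic_form (\<alpha>, \<beta>, \<mu>) v + conic_form (\<alpha>', \<beta>', \<mu>') v =
        (sqroot (\<alpha> + \<alpha>') * v $ 1 + sqroot (\<beta> + \<beta>') * v $ 2 + sqroot (\<mu> + \<mu>') * v $ 3)\<^sup>2"
      by (simp add: conic_form_def add_square power_mult_distrib algebra_simps)
    finally show "p \<in> points_on (mathon_conic (\<alpha>, \<beta>, \<mu>)) ?l"
      using p v(2) by (simp add: points_on_def span_subset_proj_line)
  qed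
  then have "card (mathon_conic (\<alpha>, \<beta>, \<mu>) \<inter> mathon_conic (\<alpha>', \<beta>', \<mu>')) \<le>
      card (points_on (mathon_conic (\<alpha>, \<beta>, \<mu>)) ?l)"
    by (rule card_mono[rotated]) simp
  also have "\<dots> \<le> 2" using assms(1) l by (rule card_points_on_conic_le)
  finally show ?thesis .
qed

end

section \<open>Groups of conics\<close>

context even_order_field
begin

text \<open>The triple \<open>(\<alpha>\<mu>, \<beta>\<mu>, \<mu>)\<close> linearises the composition: \<open>\<oplus>\<close> becomes addition.\<close>

definition param_of :: "'a \<times> 'a \<times> 'a \<Rightarrow> 'a mathon_param" where
  "param_of = (\<lambda>(u, v, m). (u / m, v / m, m))"

definition weight :: "'a \<times> 'a \<times> 'a \<Rightarrow> 'a" where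
  "weight g = snd (snd g)"

abbreviation conic_of :: "'a \<times> 'a \<times> 'a \<Rightarrow> ('a^3) set set" where
  "conic_of g \<equiv> mathon_conic (param_of g)"

lemma weight_add: "weight (g + g') = weight g + weight g'"
  by (simp add: weight_def)

lemma weight_0 [simp]: "weight 0 = 0"
  by (simp add: weight_def)

lemma param_of_eq: "param_of g = (fst g / weight g, fst (snd g) / weight g, weight g)"
  by (simp add: param_of_def weight_def split: prod.split)

lemma triple_add_self [simp]: "g + g = (0 :: 'a \<times> 'a \<times> 'a)"
  by (simp add: prod_eq_iff)

lemma triple_add_self_left [simp]: "g + (g + g') = (g' :: 'a \<times> 'a \<times> 'a)"
  by (simp flip: add.assoc)

lemma triple_add_eq_0_iff: "g + g' = 0 \<longleftrightarrow> g = (g' :: 'a \<times> 'a \<times> 'a)"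
  by (simp add: prod_eq_iff add_eq_0_iff_eq)

lemma param_of_inject:
  "weight g \<noteq> 0 \<Longrightarrow> weight g' \<noteq> 0 \<Longrightarrow> param_of g = param_of g' \<longleftrightarrow> g = g'"
  by (auto simp: param_of_eq weight_def prod_eq_iff)

lemma mathon_compose_param_of:
  assumes "weight g \<noteq> 0" "weight g' \<noteq> 0"
  shows "mathon_compose (param_of g) (param_of g') = param_of (g + g')"
  using assms by (simp add: param_of_eq mathon_compose_def weight_add)

text \<open>The complement of \<open>line_trace\<close>, so 1 means secant. The value 0 at the zero
  triple, which is no conic, allows it to be a group homomorphism.\<close>

definition line_char :: "'a \<Rightarrow> 'a \<Rightarrow> 'a \<times> 'a \<times> 'a \<Rightarrow> 'a" where
  "line_char r s g = (if g = 0 then 0 else 1 + line_trace r s (param_of g))"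

lemma line_char_0 [simp]: "line_char r s 0 = 0"
  by (simp add: line_char_def)

lemma line_char_cases: "line_char r s g = 0 \<or> line_char r s g = 1"
  using line_trace_cases[of r s "param_of g"] by (auto simp: line_char_def)

lemma points_on_conic_of_empty_iff:
  assumes "weight g \<noteq> 0"
  shows "points_on (conic_of g) (proj_line r s 1) = {} \<longleftrightarrow> line_char r s g = 0"
proof -
  have "g \<noteq> 0" using assms by auto
  then show ?thesis by (simp add: points_on_conic_off_F0_empty_iff line_char_def add_eq_0_iff_eq eq_commute[of 1])
qed

lemma card_points_on_conic_of:
  assumes "weight g \<noteq> 0" "line_char r s g = 1"
  shows "card (points_on (conic_of g) (proj_line r s 1)) = 2"
proof -
  have "g \<noteq> 0" using assms by auto
  then show ?thesis using assms(2)
    by (intro card_points_on_conic_off_F0) (simp add: line_char_def)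
qed

text \<open>For different weights, additivity on the pair holds iff \<open>pair_trace\<close> is 1,
  whatever the line. So additivity for a single line implies disjointness, and disjointness implies
  additivity for all lines.\<close>

lemma disjoint_conic_of_iff:
  assumes "weight g \<noteq> 0" "weight g' \<noteq> 0"
  shows "conic_of g \<inter> conic_of g' = {} \<longleftrightarrow>
    weight g \<noteq> weight g' \<and> line_char r s (g + g') = line_char r s g + line_char r s g'"
proof (cases "weight g = weight g'")
  case True
  then show ?thesis using assms by (simp add: param_of_eq disjoint_conics_iff)
next
  case False
  have "line_trace r s (param_of (g + g')) =
      line_trace r s (param_of g) + line_trace r s (param_of g') + pair_trace (param_of g) (param_of g')"
    unfolding mathon_compose_param_of[OF assms, symmetric]
    using False by (simp add: param_of_eq line_trace_compose)
  moreover have "g + g' \<noteq> 0" "g \<noteq> 0" "g' \<noteq> 0"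
    using False assms by (auto simp: triple_add_eq_0_iff)
  ultimately have "line_char r s (g + g') = line_char r s g + line_char r s g' \<longleftrightarrow>
      pair_trace (param_of g) (param_of g') = 1"
    by (simp add: line_char_def add.assoc add.left_commute add_eq_iff)
  then show ?thesis
    using False assms by (simp add: param_of_eq disjoint_conics_iff)
qed

text \<open>Every triple is its own negative, so closure under addition already makes this a
  subgroup.\<close>

definition arc_group :: "('a \<times> 'a \<times> 'a) set \<Rightarrow> bool" where
  "arc_group G \<longleftrightarrow> 0 \<in> G \<and> (\<forall>g\<in>G. \<forall>g'\<in>G. g + g' \<in> G) \<and> (\<forall>g\<in>G - {0}. weight g \<noteq> 0) \<and>
     (\<forall>g\<in>G - {0}. \<forall>g'\<in>G - {0}. g \<noteq> g' \<longrightarrow> conic_of g \<inter> conic_of g' = {})"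

definition arc_of :: "('a \<times> 'a \<times> 'a) set \<Rightarrow> ('a^3) set set" where
  "arc_of G = insert F0 (\<Union>g\<in>G - {0}. conic_of g)"

lemma arc_groupD:
  assumes "arc_group G"
  shows "0 \<in> G" "\<And>g g'. g \<in> G \<Longrightarrow> g' \<in> G \<Longrightarrow> g + g' \<in> G"
    "\<And>g. g \<in> G \<Longrightarrow> weight g = 0 \<longleftrightarrow> g = 0"
    "\<And>g g'. g \<in> G \<Longrightarrow> g' \<in> G \<Longrightarrow> weight g = weight g' \<longleftrightarrow> g = g'"
proof -
  show w: "weight g = 0 \<longleftrightarrow> g = 0" if "g \<in> G" for g
    using assms that by (auto simp: arc_group_def)
  show add: "g + g' \<in> G" if "g \<in> G" "g' \<in> G" for g g'
    using assms that by (auto simp: arc_group_def)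
  \<comment> \<open>The weight is additive with trivial kernel on \<open>G\<close>, hence injective
    there.\<close>
  show "weight g = weight g' \<longleftrightarrow> g = g'" if "g \<in> G" "g' \<in> G" for g g'
    using w[OF add[OF that]] by (simp add: weight_add add_eq_0_iff_eq triple_add_eq_0_iff)
qed (use assms in \<open>auto simp: arc_group_def\<close>)

lemma line_char_add:
  assumes "arc_group G" "g \<in> G" "g' \<in> G"
  shows "line_char r s (g + g') = line_char r s g + line_char r s g'"
proof (cases "g = 0 \<or> g' = 0 \<or> g = g'")
  case False
  then have "conic_of g \<inter> conic_of g' = {}"
    using assms by (auto simp: arc_group_def)
  moreover have "weight g \<noteq> 0" "weight g' \<noteq> 0" using False assms by (auto simp: arc_groupD)
  ultimately show ?thesis using disjoint_conic_of_iff by blast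
qed auto

text \<open>Adding \<open>g\<^sub>0\<close> swaps the elements of value 0 and 1.\<close>

lemma card_line_char_eq_1:
  assumes G: "arc_group G" and g0: "g0 \<in> G" "line_char r s g0 = 1"
  shows "2 * card {g \<in> G. line_char r s g = 1} = card G"
proof -
  let ?Z = "{g \<in> G. line_char r s g = 0}" and ?O = "{g \<in> G. line_char r s g = 1}"
  have "bij_betw ((+) g0) ?O ?Z"
    by (rule bij_betwI[where g = "(+) g0"])
      (use g0 in \<open>auto simp: line_char_add[OF G] arc_groupD(2)[OF G]\<close>)
  then have "card ?O = card ?Z" by (rule bij_betw_same_card)
  moreover have "?Z \<union> ?O = G" using line_char_cases by blast
  moreover have "card (?Z \<union> ?O) = card ?Z + card ?O" by (rule card_Un_disjoint) auto
  ultimately show ?thesis by presburger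
qed

section \<open>The maximal arc of a group of conics\<close>

lemma conic_of_through_F0:
  assumes "(a, b) \<noteq> (0, 0)" "weight g \<noteq> 0"
  shows "points_on (conic_of g) (proj_line a b 0) = {conic_point a b (param_of g)}"
  using assms by (simp add: param_of_eq points_on_conic_through_F0)

lemma F0_not_in_conic_of: "weight g \<noteq> 0 \<Longrightarrow> F0 \<notin> conic_of g"
  by (simp add: param_of_eq F0_not_in_mathon_conic)

lemma points_on_arc_of:
  "points_on (arc_of G) l =
     (if F0 \<subseteq> l then {F0} else {}) \<union> (\<Union>g\<in>G - {0}. points_on (conic_of g) l)"
  by (auto simp: points_on_def arc_of_def)

text \<open>Each of the \<open>card G - 1\<close> conics contributes one point of the line, these
  points differ by disjointness, and \<open>F0\<close> is one more.\<close>

lemma card_points_on_arc_of_through_F0: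
  assumes G: "arc_group G" and ab: "(a, b) \<noteq> (0, 0)"
  shows "card (points_on (arc_of G) (proj_line a b 0)) = card G"
proof -
  let ?P = "\<lambda>g. conic_point a b (param_of g)"
  have w: "weight g \<noteq> 0" if "g \<in> G - {0}" for g using that by (simp add: arc_groupD[OF G])
  have P: "?P g \<in> conic_of g" if "g \<in> G - {0}" for g
    using conic_of_through_F0[OF ab w[OF that]] by (auto simp: points_on_def)
  have "inj_on ?P (G - {0})"
  proof (rule inj_onI, rule ccontr)
    fix g g' assume g: "g \<in> G - {0}" "g' \<in> G - {0}" "?P g = ?P g'" "g \<noteq> g'"
    have "?P g \<in> conic_of g \<inter> conic_of g'" using P[OF g(1)] P[OF g(2)] g(3) by simp
    moreover have "conic_of g \<inter> conic_of g' = {}" using G g by (auto simp: arc_group_def)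
    ultimately show False by blast
  qed
  then have "card (?P ` (G - {0})) = card G - 1"
    using arc_groupD(1)[OF G] by (simp add: card_image)
  moreover have "F0 \<notin> ?P ` (G - {0})"
  proof
    assume "F0 \<in> ?P ` (G - {0})"
    then obtain g where g: "g \<in> G - {0}" "F0 = ?P g" by blast
    then show False using P[OF g(1)] F0_not_in_conic_of[OF w[OF g(1)]] by simp
  qed
  moreover have "points_on (arc_of G) (proj_line a b 0) = insert F0 (?P ` (G - {0}))"
  proof -
    have "(\<Union>g\<in>G - {0}. points_on (conic_of g) (proj_line a b 0)) = (\<Union>g\<in>G - {0}. {?P g})"
      using conic_of_through_F0[OF ab w] by (rule SUP_cong[OF refl])
    then show ?thesis
      by (simp only: points_on_arc_of F0_subset_proj_line UNION_singleton_eq_range simp_thms if_True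
          insert_is_Un[symmetric])
  qed
  moreover have "card G > 0" using arc_groupD(1)[OF G] by (auto simp: card_gt_0_iff)
  ultimately show ?thesis by simp
qed

lemma card_points_on_arc_of_off_F0:
  assumes G: "arc_group G"
  shows "card (points_on (arc_of G) (proj_line r s 1)) = 2 * card {g \<in> G. line_char r s g = 1}"
proof -
  have w: "weight g \<noteq> 0" if "g \<in> G - {0}" for g using that by (simp add: arc_groupD[OF G])
  let ?O = "{g \<in> G. line_char r s g = 1}" and ?l = "proj_line r s 1"
  have O: "g \<in> G - {0}" "weight g \<noteq> 0" if "g \<in> ?O" for g
    using that by (auto simp: arc_groupD[OF G])
  have "(\<Union>g\<in>G - {0}. points_on (conic_of g) ?l) = (\<Union>g\<in>?O. points_on (conic_of g) ?l)"
  proof (intro equalityI UN_least subsetI)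
    fix g p assume g: "g \<in> G - {0}" "p \<in> points_on (conic_of g) ?l"
    then have "line_char r s g \<noteq> 0"
      using points_on_conic_of_empty_iff[OF w] by blast
    then have "g \<in> ?O" using g line_char_cases[of r s g] by blast
    then show "p \<in> (\<Union>g\<in>?O. points_on (conic_of g) ?l)" using g(2) by blast
  next
    fix g p assume "g \<in> ?O" "p \<in> points_on (conic_of g) ?l"
    then show "p \<in> (\<Union>g\<in>G - {0}. points_on (conic_of g) ?l)" using O by blast
  qed
  then have "points_on (arc_of G) ?l = (\<Union>g\<in>?O. points_on (conic_of g) ?l)"
    by (simp add: points_on_arc_of F0_subset_proj_line)
  also have "card \<dots> = (\<Sum>g\<in>?O. card (points_on (conic_of g) ?l))"
  proof (intro card_UN_disjoint ballI impI)
    fix g g' assume "g \<in> ?O" "g' \<in> ?O" "g \<noteq> g'"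
    then have "conic_of g \<inter> conic_of g' = {}"
      using G O(1) unfolding arc_group_def by blast
    then show "points_on (conic_of g) ?l \<inter> points_on (conic_of g') ?l = {}"
      by (auto simp: points_on_def)
  qed auto
  also have "\<dots> = (\<Sum>g\<in>?O. 2)"
    using O(2) by (intro sum.cong refl card_points_on_conic_of) auto
  finally show ?thesis by simp
qed

text \<open>Off \<open>F0\<close> a nontrivial character takes the value 1 on half of the group, and
  each such conic contributes two points; a trivial character means an external line.\<close>

lemma card_points_on_arc_of:
  assumes G: "arc_group G" and l: "l \<in> pg_lines"
  shows "card (points_on (arc_of G) l) \<in> {0, card G}"
  using l
proof (cases l rule: pg_line_cases)
  case (through_F0 a b)
  then show ?thesis by (simp add: card_points_on_arc_of_through_F0[OF G])
next
  case (off_F0 r s)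
  show ?thesis
  proof (cases "\<exists>g0\<in>G. line_char r s g0 = 1")
    case True
    then show ?thesis
      using card_line_char_eq_1[OF G] by (auto simp: off_F0 card_points_on_arc_of_off_F0[OF G])
  next
    case False
    then have "{g \<in> G. line_char r s g = 1} = {}" by blast
    then show ?thesis by (simp only: off_F0 card_points_on_arc_of_off_F0[OF G]) simp
  qed
qed

lemma card_le_points_on_line_through_F0: "CARD('a) \<le> card (points_on pg_points (proj_line 1 0 (0::'a)))"
proof -
  let ?P = "\<lambda>t. vec.span {vector [0, 1, t] :: 'a^3}"
  have "inj ?P"
  proof (rule injI)
    fix t u assume "?P t = ?P u"
    then have "vector [0, 1, t] \<in> ?P u" by (metis insertI1 vec.span_base)
    then show "t = u" by (auto simp: vec.span_singleton vec3_eq_iff)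
  qed
  then have "CARD('a) = card (range ?P)" by (simp add: card_image)
  also have "range ?P \<subseteq> points_on pg_points (proj_line 1 0 0)"
    by (rule image_subsetI)
      (simp add: points_on_def span_subset_proj_line pg_points_spanI vector3_eq_0_iff)
  then have "card (range ?P) \<le> card (points_on pg_points (proj_line 1 0 (0::'a)))"
    by (rule card_mono[rotated]) simp
  finally show ?thesis .
qed

lemma arc_of_pg_points: "arc_of G \<subseteq> pg_points"
  unfolding arc_of_def using mathon_conic_pg_points F0_pg_point by blast

lemma arc_of_ne_pg_points:
  assumes G: "arc_group G" and q: "card G < CARD('a)"
  shows "arc_of G \<noteq> pg_points"
proof
  assume "arc_of G = pg_points"
  then have "card (points_on pg_points (proj_line 1 0 (0::'a))) = card G"
    using card_points_on_arc_of_through_F0[OF G, of 1 0] by simp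
  then show False using q card_le_points_on_line_through_F0 by simp
qed

lemma maximal_arc_arc_of:
  assumes G: "arc_group G" and q: "card G < CARD('a)" "card G \<noteq> 1"
  shows "maximal_arc (card G) (arc_of G)"
proof -
  have "arc_of G \<noteq> {}" by (simp add: arc_of_def)
  then show ?thesis
    using arc_of_ne_pg_points[OF G q(1)] arc_of_pg_points card_points_on_arc_of[OF G] q
    by (simp add: maximal_arc_def psubset_eq)
qed

text \<open>The external line through X supplied by counting avoids \<open>F0\<close>, hence has the
  form z = r x + s y, and its character is trivial on G.\<close>

lemma ex_external_line_arc_of:
  assumes G: "arc_group G" and X: "X \<in> pg_points" "X \<notin> arc_of G"
  obtains r s where "X \<subseteq> proj_line r s 1" "\<And>g. g \<in> G \<Longrightarrow> line_char r s g = 0"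
proof -
  have F0: "F0 \<in> arc_of G" by (simp add: arc_of_def)
  obtain l where l: "l \<in> pg_lines" "X \<subseteq> l" "points_on (arc_of G) l = {}"
    using ex_external_line[OF arc_of_pg_points card_points_on_arc_of[OF G] F0 X] by blast
  from F0 have "\<not> F0 \<subseteq> l" using l(3) by (auto simp: points_on_def)
  with l(1) obtain r s where rs: "l = proj_line r s 1"
    by (cases rule: pg_line_cases) (auto simp: F0_subset_proj_line)
  have "{g \<in> G. line_char r s g = 1} = {}"
    using card_points_on_arc_of_off_F0[OF G, of r s] l(3) rs by simp
  then have "line_char r s g = 0" if "g \<in> G" for g using that line_char_cases by blast
  then show ?thesis using that l(2) rs by blast
qed

section \<open>Moving an external line to z = 0\<close>

definition shear :: "'a \<Rightarrow> 'a \<Rightarrow> 'a^3^3" where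
  "shear r s = vector [vector [1, 0, 0], vector [0, 1, 0], vector [r, s, 1]]"

lemma shear_mult: "shear r s *v v = vector [v $ 1, v $ 2, r * v $ 1 + s * v $ 2 + v $ 3]"
  by (simp add: shear_def vec3_eq_iff matrix_vector_mult_def sum_3)

lemma shear_shear: "shear r s *v (shear r s *v v) = v"
  by (simp add: shear_mult vec3_eq_iff add.assoc[symmetric])

lemma invertible_shear: "invertible (shear r s)"
  by (simp add: invertible_det_nz shear_def det_3)

lemma shear_F0: "change_coords (shear r s) F0 = F0"
  unfolding F0_def by (simp add: change_coords_span shear_mult)

text \<open>Replacing z by z + r x + s y changes only the coefficients of x^2 and y^2, as squaring
  is additive. The shear fixes \<open>F0\<close> and carries z = 0 to z = r x + s y.\<close>

lemma shear_mathon_conic: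
  "change_coords (shear r s) ` mathon_conic (\<alpha> + \<mu> * r\<^sup>2, \<beta> + \<mu> * s\<^sup>2, \<mu>) = mathon_conic (\<alpha>, \<beta>, \<mu>)"
proof -
  let ?w' = "(\<alpha> + \<mu> * r\<^sup>2, \<beta> + \<mu> * s\<^sup>2, \<mu>)" and ?S = "shear r s"
  have form: "conic_form (\<alpha>, \<beta>, \<mu>) (?S *v v) = conic_form ?w' v" for v
    unfolding conic_form_def split shear_mult vector_3 add_square
    by (simp add: algebra_simps power2_eq_square)
  have nz: "?S *v v \<noteq> 0" if "v \<noteq> 0" for v
    using that by (metis shear_shear matrix_vector_mult_0_right)
  show ?thesis
  proof (intro equalityI subsetI)
    fix p assume "p \<in> change_coords ?S ` mathon_conic ?w'"
    then obtain v where v: "v \<noteq> 0" "p = change_coords ?S (vec.span {v})" "conic_form ?w' v = 0"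
      by (auto elim: mathon_conicE)
    then show "p \<in> mathon_conic (\<alpha>, \<beta>, \<mu>)"
      by (simp add: change_coords_span span_in_mathon_conic_iff nz form)
  next
    fix p assume "p \<in> mathon_conic (\<alpha>, \<beta>, \<mu>)"
    then obtain v where v: "v \<noteq> 0" "p = vec.span {v}" "conic_form (\<alpha>, \<beta>, \<mu>) v = 0"
      by (rule mathon_conicE)
    have "p = change_coords ?S (vec.span {?S *v v})"
      by (simp add: v(2) change_coords_span shear_shear)
    moreover have "vec.span {?S *v v} \<in> mathon_conic ?w'"
      using v by (simp add: span_in_mathon_conic_iff nz shear_shear flip: form)
    ultimately show "p \<in> change_coords ?S ` mathon_conic ?w'" by blast
  qed
qed

text \<open>The trace condition says that z = 0 is external to each conic. Some external line z = r
  x + s y of the arc exists, and shearing it to z = 0 turns \<open>line_trace r s = 1\<close> into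
  that condition, while the composition is respected.\<close>

lemma mathon_type_arc_of:
  assumes G: "arc_group G" and q: "card G < CARD('a)" "card G \<noteq> 1"
  shows "mathon_type (arc_of G)"
proof -
  obtain X where X: "X \<in> pg_points" "X \<notin> arc_of G"
    using arc_of_ne_pg_points[OF G q(1)] arc_of_pg_points by blast
  obtain r s where rs: "\<And>g. g \<in> G \<Longrightarrow> line_char r s g = 0"
    using ex_external_line_arc_of[OF G X] by metis
  define sh where "sh = (\<lambda>(\<alpha>, \<beta>, \<mu>::'a). (\<alpha> + \<mu> * r\<^sup>2, \<beta> + \<mu> * s\<^sup>2, \<mu>))"
  define P where "P = (\<lambda>g. sh (param_of g)) ` (G - {0})"
  have w: "weight g \<noteq> 0" if "g \<in> G - {0}" for g using that by (simp add: arc_groupD[OF G])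
  have sh_compose: "mathon_compose (sh p) (sh p') = sh (mathon_compose p p')"
    if "snd (snd p) \<noteq> snd (snd p')" for p p'
  proof -
    obtain a b m a' b' m' where p: "p = (a, b, m)" "p' = (a', b', m')" by (metis prod_cases3)
    have ne: "m + m' \<noteq> 0" using that p by (simp add: add_eq_0_iff_eq)
    have "(a * m + a' * m') / (m + m') + (m + m') * c =
        ((a + m * c) * m + (a' + m' * c) * m') / (m + m')" for a a' c
      using ne by (simp add: field_simps)
    then show ?thesis by (simp only: p sh_def mathon_compose_def split)
  qed
  have "P \<noteq> {}"
  proof
    assume "P = {}"
    then have "G = {0}" using arc_groupD(1)[OF G] by (auto simp: P_def)
    then show False using q(2) by simp
  qed
  moreover have "closed_mathon_set P"
    unfolding closed_mathon_set_def
  proof (intro conjI ballI impI)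
    fix F assume "F \<in> P"
    then obtain g where g: "g \<in> G - {0}" "F = sh (param_of g)" by (auto simp: P_def)
    then have "line_trace r s (param_of g) = 1"
      using rs[of g] by (simp add: line_char_def add_eq_0_iff_eq)
    then show "case F of (\<alpha>, \<beta>, \<mu>) \<Rightarrow> abs_trace (\<alpha> * \<beta>) = 1 \<and> \<mu> \<noteq> 0"
      using g w[of g] by (simp add: sh_def param_of_eq line_trace_def)
  next
    show "inj_on (\<lambda>(\<alpha>, \<beta>, \<mu>). \<mu>) P"
      by (rule inj_onI) (auto simp: P_def sh_def param_of_eq arc_groupD[OF G])
  next
    fix F F' assume "F \<in> P" "F' \<in> P" "F \<noteq> F'"
    then obtain g g' where g: "g \<in> G - {0}" "F = sh (param_of g)" "g' \<in> G - {0}" "F' = sh (param_of g')"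
        "g \<noteq> g'"
      unfolding P_def by blast
    then have "weight g \<noteq> weight g'" by (simp add: arc_groupD(4)[OF G])
    then have "snd (snd (param_of g)) \<noteq> snd (snd (param_of g'))" by (simp add: param_of_eq)
    then have "mathon_compose F F' = sh (param_of (g + g'))"
      by (simp only: g(2,4) sh_compose mathon_compose_param_of w[OF g(1)] w[OF g(3)] not_False_eq_True)
    moreover have "g + g' \<in> G - {0}"
      using g arc_groupD(2)[OF G] by (simp add: triple_add_eq_0_iff)
    ultimately show "mathon_compose F F' \<in> P" by (auto simp: P_def)
  qed
  moreover have "arc_of G = change_coords (shear r s) ` mathon_point_set P"
  proof -
    have "change_coords (shear r s) ` mathon_conic (sh p) = mathon_conic p" for p
      by (cases p) (simp add: sh_def shear_mathon_conic)
    then have "change_coords (shear r s) ` (\<Union>F\<in>P. mathon_conic F) = (\<Union>g\<in>G - {0}. conic_of g)"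
      by (simp only: P_def image_UN image_image)
    then show ?thesis by (simp only: arc_of_def mathon_point_set_def image_insert shear_F0)
  qed
  ultimately show ?thesis
    unfolding mathon_type_def by (intro exI[of _ "shear r s"] exI[of _ P]) (simp add: invertible_shear)
qed

text \<open>Disjointness from \<open>c\<close> makes all characters additive on pairs from
  \<open>c\<close> and \<open>G\<close>. They are then additive on the whole new group, and this
  additivity gives back the pairwise disjointness of its conics.\<close>

lemma arc_group_extend:
  assumes G: "arc_group G" and c: "weight c \<noteq> 0"
    and disj: "\<And>g. g \<in> G - {0} \<Longrightarrow> conic_of c \<inter> conic_of g = {}"
  shows "arc_group (G \<union> (+) c ` G)" (is "arc_group ?G")
    and "card (G \<union> (+) c ` G) = 2 * card G"
proof -
  have w: "weight g \<noteq> 0" if "g \<in> G - {0}" for g using that by (simp add: arc_groupD[OF G])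
  have cg: "weight (c + g) \<noteq> 0" "line_char r s (c + g) = line_char r s c + line_char r s g"
    if "g \<in> G" for g r s
  proof -
    show "weight (c + g) \<noteq> 0"
      using disj[of g] that c w[of g] disjoint_conic_of_iff[of c g]
      by (cases "g = 0") (auto simp: weight_add add_eq_0_iff_eq)
    show "line_char r s (c + g) = line_char r s c + line_char r s g"
      using disj[of g] that c w[of g] disjoint_conic_of_iff[of c g r s]
      by (cases "g = 0") auto
  qed
  have mem: "g \<in> ?G \<longleftrightarrow> g \<in> G \<or> c + g \<in> G" for g
    by (metis Un_iff image_iff triple_add_self_left)
  have add: "g + g' \<in> ?G" if "g \<in> ?G" "g' \<in> ?G" for g g'
  proof -
    have "c + (g + g') = (c + g) + g'" "c + (g + g') = g + (c + g')" "g + g' = (c + g) + (c + g')"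
      by (simp_all add: add.assoc add.left_commute[of _ c])
    then show ?thesis using that arc_groupD(2)[OF G] unfolding mem by metis
  qed
  have wt: "weight g \<noteq> 0" if "g \<in> ?G - {0}" for g
    using that w cg(1) by blast
  have char: "line_char r s (g + g') = line_char r s g + line_char r s g'"
    if g: "g \<in> ?G" "g' \<in> ?G" for g g' r s
  proof -
    \<comment> \<open>Elements of the new group are sums of an element of {0, c} and an element of
      the old group; additivity is checked on each component.\<close>
    obtain e x where x: "x \<in> G" "e = 0 \<or> e = c" "g = e + x"
      using g(1) by (metis Un_iff add_0 imageE)
    obtain e' x' where x': "x' \<in> G" "e' = 0 \<or> e' = c" "g' = e' + x'"
      using g(2) by (metis Un_iff add_0 imageE)
    have e: "line_char r s (k + y) = line_char r s k + line_char r s y" if "y \<in> G" "k = 0 \<or> k = c" for k y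
      using that cg(2) by fastforce
    have xx': "x + x' \<in> G" using arc_groupD(2)[OF G] x x' by blast
    have "g + g' = (e + e') + (x + x')" by (simp add: x x' algebra_simps)
    moreover have "e + e' = 0 \<or> e + e' = c" "line_char r s (e + e') = line_char r s e + line_char r s e'"
      using x(2) x'(2) by fastforce+
    ultimately show ?thesis
      using x x' xx' by (simp only: e line_char_add[OF G]) (simp add: algebra_simps)
  qed
  show "arc_group ?G"
    unfolding arc_group_def
  proof (intro conjI ballI impI)
    fix g g' assume g: "g \<in> ?G - {0}" "g' \<in> ?G - {0}" "g \<noteq> g'"
    have "weight (g + g') \<noteq> 0"
      using g add[of g g'] wt[of "g + g'"] by (auto simp: triple_add_eq_0_iff)
    then have "weight g \<noteq> weight g'" by (auto simp: weight_add)
    then show "conic_of g \<inter> conic_of g' = {}"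
      \<comment> \<open>One line is enough to deduce disjointness; z = 0 is taken.\<close>
      using wt g char by (subst disjoint_conic_of_iff[of g g' 0 0]) auto
  qed (use arc_groupD(1)[OF G] add wt in auto)
  have "G \<inter> (+) c ` G = {}"
  proof (rule ccontr)
    assume "G \<inter> (+) c ` G \<noteq> {}"
    then obtain g where g: "g \<in> G" "c + g \<in> G" by blast
    then have "c + g + g \<in> G" using arc_groupD(2)[OF G] by blast
    \<comment> \<open>Otherwise the conic of \<open>c\<close> would belong to the old group and be
      disjoint from itself, although it is nonempty.\<close>
    then have "c \<in> G - {0}" using c by (auto simp: add.assoc)
    moreover have "conic_of c \<noteq> {}"
      using conic_of_through_F0[of 1 0 c] c by (auto simp: points_on_def)
    ultimately show False using disj by blast
  qed
  moreover have "card ((+) c ` G) = card G" by (simp add: card_image)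
  ultimately show "card ?G = 2 * card G" by (simp add: card_Un_disjoint)
qed

text \<open>The q lines t x + y = 0 through \<open>F0\<close> each carry a point of the conic, and
  these points are distinct.\<close>

lemma card_le_conic_of:
  assumes "weight g \<noteq> 0"
  shows "CARD('a) \<le> card (conic_of g)"
proof -
  let ?P = "\<lambda>t. conic_point t 1 (param_of g)"
  have "inj ?P"
  proof (rule injI)
    fix t u assume e: "?P t = ?P u"
    obtain z z' where z: "?P t = vec.span {vector [1, t, z]}" "?P u = vec.span {vector [1, u, z']}"
      by (simp add: conic_point_def param_of_eq)
    have "vector [1, t, z] \<in> vec.span {vector [1, u, z'] :: 'a^3}"
      using e z by (metis insertI1 vec.span_base)
    then show "t = u" by (auto simp: vec.span_singleton vec3_eq_iff)
  qed
  then have "CARD('a) = card (range ?P)" by (simp add: card_image)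
  also have "range ?P \<subseteq> conic_of g"
    using conic_of_through_F0[of _ 1 g] assms by (auto simp: points_on_def)
  then have "card (range ?P) \<le> card (conic_of g)" by (rule card_mono[rotated]) simp
  finally show ?thesis .
qed

text \<open>The composition of two conics of \<open>M\<close> lies in \<open>M\<close>, since through a point outside \<open>M\<close> there
  is a line missing \<open>M\<close>, hence missing both conics and their composition. As conics meet in at
  most two points, it then has too many points not to be one of the given conics.\<close>

lemma arc_group_of_maximal_arc:
  assumes M: "maximal_arc d M" "M = insert F0 (\<Union>g\<in>V. conic_of g)"
    and q: "2 * d < CARD('a)"
    and V: "\<And>g. g \<in> V \<Longrightarrow> weight g \<noteq> 0" "card V = d - 1"
  shows "arc_group (insert 0 V)" "card (insert 0 V) = d" "arc_of (insert 0 V) = M"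
proof -
  have M': "M \<subseteq> pg_points" "card (points_on M l) \<in> {0, d}" if "l \<in> pg_lines" for l
    using M(1) that by (auto simp: maximal_arc_def)
  have F0: "F0 \<in> M" using M(2) by simp
  have V0: "0 \<notin> V" using V(1) weight_0 by blast
  have card_F0: "card (points_on M l) = d" "d > 0" if l: "l \<in> pg_lines" "F0 \<subseteq> l" for l
  proof -
    have "F0 \<in> points_on M l" using l F0 by (simp add: points_on_def)
    then have "card (points_on M l) \<noteq> 0" by auto
    then show "card (points_on M l) = d" "d > 0" using M'(2)[OF l(1)] by auto
  qed
  have d: "d > 0"
    using card_F0(2)[of "proj_line 1 0 0"] by (simp add: proj_line_in_pg_lines F0_subset_proj_line)
  show card: "card (insert 0 V) = d" using V(2) V0 d by simp
  show "arc_of (insert 0 V) = M" using V0 M(2) by (auto simp: arc_of_def)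
  \<comment> \<open>The line joining a common point X to \<open>F0\<close> has d points of
    \<open>M\<close>: \<open>F0\<close> and one from each of only d - 1 conics. None of these points
    can coincide, so two conics cannot share X.\<close>
  have disj: "conic_of g \<inter> conic_of g' = {}" if g: "g \<in> V" "g' \<in> V" "g \<noteq> g'" for g g'
  proof (rule ccontr)
    assume "conic_of g \<inter> conic_of g' \<noteq> {}"
    then obtain X where X: "X \<in> conic_of g" "X \<in> conic_of g'" by blast
    have "X \<noteq> F0" "X \<in> pg_points"
      using X F0_not_in_conic_of V(1) g mathon_conic_pg_points by blast+
    then obtain l where l: "l \<in> pg_lines" "X \<subseteq> l" "F0 \<subseteq> l"
      using ex1_line_through F0_pg_point by metis
    from l(1,3) obtain a b where ab: "(a, b) \<noteq> (0, 0)" "l = proj_line a b 0"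
      by (cases rule: pg_line_cases) (auto simp: F0_subset_proj_line)
    let ?P = "\<lambda>g. conic_point a b (param_of g)"
    have P: "points_on (conic_of g) l = {?P g}" if "g \<in> V" for g
      using ab V(1)[OF that] by (simp add: conic_of_through_F0)
    have "points_on M l = insert F0 (\<Union>g\<in>V. points_on (conic_of g) l)"
      using M(2) l(3) by (auto simp: points_on_def)
    also have "\<dots> = insert F0 (?P ` V)" using P by auto
    finally have "d \<le> card (insert F0 (?P ` V))" using card_F0(1)[OF l(1,3)] by simp
    also have "\<dots> \<le> Suc (card (?P ` V))" by (rule card_insert_le_m1) auto
    finally have "card V \<le> card (?P ` V)" using V(2) by simp
    then have "inj_on ?P V" by (intro eq_card_imp_inj_on antisym card_image_le) simp_all
    moreover have "X \<in> points_on (conic_of g) l" "X \<in> points_on (conic_of g') l"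
      using X l(2) by (auto simp: points_on_def)
    then have "?P g = ?P g'" using P g by simp
    ultimately show False using g by (auto dest: inj_onD)
  qed
  have closed: "g + g' \<in> V" if g: "g \<in> V" "g' \<in> V" "g \<noteq> g'" for g g'
  proof (rule ccontr)
    assume ng: "g + g' \<notin> V"
    have add: "weight g \<noteq> weight g'" "line_char r s (g + g') = line_char r s g + line_char r s g'" for r s
      using disjoint_conic_of_iff[of g g' r s] disj[OF g] V(1) g by blast+
    have w: "weight (g + g') \<noteq> 0" using add(1) by (simp add: weight_add add_eq_0_iff_eq)
    have sub: "conic_of (g + g') \<subseteq> M"
    proof (rule subsetI, rule ccontr)
      fix X assume X: "X \<in> conic_of (g + g')" "X \<notin> M"
      have "X \<in> pg_points" using X mathon_conic_pg_points by blast
      then obtain l where l: "l \<in> pg_lines" "X \<subseteq> l" "points_on M l = {}"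
        using ex_external_line[of M d F0 X] M' F0 X(2) M(1) by (auto simp: maximal_arc_def)
      have "\<not> F0 \<subseteq> l" using l(3) F0 by (auto simp: points_on_def)
      with l(1) obtain r s where rs: "l = proj_line r s 1"
        by (cases rule: pg_line_cases) (auto simp: F0_subset_proj_line)
      have "line_char r s k = 0" if "k \<in> V" for k
      proof -
        have "points_on (conic_of k) l = {}" using l(3) M(2) that by (auto simp: points_on_def)
        then show ?thesis using points_on_conic_of_empty_iff[OF V(1)[OF that]] rs by blast
      qed
      then have "line_char r s (g + g') = 0" using add(2) g by simp
      then have "points_on (conic_of (g + g')) l = {}"
        using points_on_conic_of_empty_iff[OF w] rs by blast
      then show False using X(1) l(2) by (auto simp: points_on_def)
    qed
    \<comment> \<open>A conic covered by d - 1 others, each meeting it at most twice, has at most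
      2(d - 1) < q points, which is too few.\<close>
    have "conic_of (g + g') \<subseteq> (\<Union>k\<in>V. conic_of (g + g') \<inter> conic_of k)"
      using sub M(2) F0_not_in_conic_of[OF w] by auto
    then have "card (conic_of (g + g')) \<le> card (\<Union>k\<in>V. conic_of (g + g') \<inter> conic_of k)"
      by (rule card_mono[rotated]) simp
    also have "\<dots> \<le> (\<Sum>k\<in>V. card (conic_of (g + g') \<inter> conic_of k))" by (rule card_UN_le) simp
    also have "\<dots> \<le> (\<Sum>k\<in>V. 2)"
    proof (rule sum_mono)
      fix k assume k: "k \<in> V"
      then have "param_of (g + g') \<noteq> param_of k"
        using ng w V(1) by (auto simp: param_of_inject)
      then show "card (conic_of (g + g') \<inter> conic_of k) \<le> 2"
        unfolding param_of_eq using w by (intro card_inter_conics_le) auto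
    qed
    also have "\<dots> < CARD('a)" using q V(2) by simp
    finally show False using card_le_conic_of[OF w] by simp
  qed
  show "arc_group (insert 0 V)"
    unfolding arc_group_def
  proof (intro conjI ballI impI)
    fix g g' assume g: "g \<in> insert 0 V" "g' \<in> insert 0 V"
    show "g + g' \<in> insert 0 V"
    proof (cases "g = 0 \<or> g' = 0 \<or> g = g'")
      case True
      then show ?thesis using g by (metis add_0 add_0_right insertI1 triple_add_self)
    next
      case False
      then have "g + g' \<in> V" using g by (intro closed) simp_all
      then show ?thesis by simp
    qed
  next
    fix g assume "g \<in> insert 0 V - {0}"
    then show "weight g \<noteq> 0" using V(1) by blast
  next
    fix g g' assume "g \<in> insert 0 V - {0}" "g' \<in> insert 0 V - {0}" "g \<noteq> g'"
    then show "conic_of g \<inter> conic_of g' = {}" using disj by blast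
  qed simp
qed

text \<open>The group generated by \<open>c\<close> and the triples of \<open>M\<close> gives
  existence. For uniqueness, external lines yield one inclusion and counting on lines through
  \<open>F0\<close> the other.\<close>

lemma arc_extension:
  assumes M: "maximal_arc d M" "M = insert F0 (\<Union>g\<in>V. conic_of g)"
    and q: "2 * d < CARD('a)"
    and V: "\<And>g. g \<in> V \<Longrightarrow> weight g \<noteq> 0" "card V = d - 1"
    and c: "weight c \<noteq> 0" "conic_of c \<inter> M = {}"
  obtains M' where "maximal_arc (2 * d) M'" "mathon_type M'" "M \<union> conic_of c \<subseteq> M'"
    "\<And>M''. maximal_arc (2 * d) M'' \<Longrightarrow> M \<union> conic_of c \<subseteq> M'' \<Longrightarrow> M'' = M'"
proof -
  let ?G = "insert 0 V"
  note G = arc_group_of_maximal_arc[OF M q V]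
  have M_eq: "M = insert F0 (\<Union>g\<in>?G - {0}. conic_of g)"
    using G(3) by (simp add: arc_of_def)
  then have disj: "conic_of c \<inter> conic_of g = {}" if "g \<in> ?G - {0}" for g
    using c(2) that by blast
  define G' where "G' = ?G \<union> (+) c ` ?G"
  have G': "arc_group G'" "card G' = 2 * d"
    using arc_group_extend[OF G(1) c(1) disj] G(2) by (simp_all add: G'_def)
  have c': "c \<in> G'" "c \<noteq> 0" using c(1) by (auto simp: G'_def)
  have sub: "M \<union> conic_of c \<subseteq> arc_of G'"
  proof -
    have "?G - {0} \<subseteq> G' - {0}" "c \<in> G' - {0}" using c' by (auto simp: G'_def)
    then show ?thesis unfolding M_eq arc_of_def by blast
  qed
  have uniq: "M'' = arc_of G'" if M'': "maximal_arc (2 * d) M''" "M \<union> conic_of c \<subseteq> M''" for M''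
  proof (intro equalityI subsetI)
    have pts: "M'' \<subseteq> pg_points" and lines: "\<And>l. l \<in> pg_lines \<Longrightarrow> card (points_on M'' l) \<in> {0, 2 * d}"
      using M''(1) by (auto simp: maximal_arc_def)
    have F0: "F0 \<in> M''" using M(2) M''(2) by auto
    \<comment> \<open>A point outside \<open>M''\<close> lies on a line missing \<open>M''\<close>,
      hence missing \<open>M\<close> and the new conic. Its character vanishes on generators of
      \<open>G'\<close>, so the line misses the whole arc of \<open>G'\<close>.\<close>
    show sup: "X \<in> M''" if X: "X \<in> arc_of G'" for X
    proof (rule ccontr)
      assume "X \<notin> M''"
      then obtain l where l: "l \<in> pg_lines" "X \<subseteq> l" "points_on M'' l = {}"
        using ex_external_line[OF pts lines F0, of X] X arc_of_pg_points by blast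
      have nF0: "\<not> F0 \<subseteq> l" using l(3) F0 by (auto simp: points_on_def)
      with l(1) obtain r s where rs: "l = proj_line r s 1"
        by (cases rule: pg_line_cases) (auto simp: F0_subset_proj_line)
      have 0: "line_char r s k = 0" if "conic_of k \<subseteq> M''" "weight k \<noteq> 0" for k
      proof -
        have "points_on (conic_of k) l = {}" using l(3) that(1) by (auto simp: points_on_def)
        then show ?thesis using points_on_conic_of_empty_iff[OF that(2)] rs by blast
      qed
      have V0: "line_char r s k = 0" if "k \<in> ?G" for k
        using that V(1)[of k] M(2) M''(2) by (cases "k = 0") (auto intro!: 0)
      have c0: "line_char r s c = 0" using M''(2) c(1) by (intro 0) auto
      have "line_char r s k = 0" if k: "k \<in> G'" for k
      proof -
        consider "k \<in> ?G" | x where "x \<in> ?G" "k = c + x" using k unfolding G'_def by blast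
        then show ?thesis
        proof cases
          case (2 x)
          then have "x \<in> G'" unfolding G'_def by blast
          then show ?thesis using line_char_add[OF G'(1) c'(1)] 2 V0[of x] c0 by simp
        qed (rule V0)
      qed
      then have "{g \<in> G'. line_char r s g = 1} = {}" by auto
      then have "card (points_on (arc_of G') l) = 0"
        unfolding rs card_points_on_arc_of_off_F0[OF G'(1)] by simp
      then show False using X l(2) by (auto simp: points_on_def)
    qed
    fix X assume X: "X \<in> M''"
    show "X \<in> arc_of G'"
    proof (cases "X = F0")
      case False
      then obtain l where l: "l \<in> pg_lines" "F0 \<subseteq> l" "X \<subseteq> l"
        using ex1_line_through[OF F0_pg_point, of X] X pts by blast
      from l(1,2) obtain a b where ab: "(a, b) \<noteq> (0, 0)" "l = proj_line a b 0"
        by (cases rule: pg_line_cases) (auto simp: F0_subset_proj_line)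
      \<comment> \<open>On a line through \<open>F0\<close> the constructed arc already has
        \<open>2 * d\<close> points, the most that \<open>M''\<close> can have there.\<close>
      have "points_on (arc_of G') l \<subseteq> points_on M'' l" using sup by (auto simp: points_on_def)
      moreover have "card (points_on M'' l) \<le> card (points_on (arc_of G') l)"
        using lines[OF l(1)] card_points_on_arc_of_through_F0[OF G'(1) ab(1)] G'(2) ab(2) by auto
      ultimately have "points_on (arc_of G') l = points_on M'' l" by (intro card_seteq) auto
      then show ?thesis using X l(3) by (auto simp: points_on_def)
    qed (simp add: arc_of_def)
  qed
  have "2 * d \<noteq> 1" by presburger
  then have G'_card: "card G' < CARD('a)" "card G' \<noteq> 1" using G'(2) q by simp_all
  show ?thesis
  proof (rule that)
    show "maximal_arc (2 * d) (arc_of G')"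
      using maximal_arc_arc_of[OF G'(1) G'_card] G'(2) by simp
    show "mathon_type (arc_of G')" using G'(1) G'_card by (rule mathon_type_arc_of)
  qed (fact sub uniq)+
qed

end

section \<open>Choice of coordinates\<close>

text \<open>The matrix need not be symmetric: the polar form is the symmetrisation of this form and
  inherits its bilinearity.\<close>

definition bil_form :: "'a::field^3^3 \<Rightarrow> 'a^3 \<Rightarrow> 'a^3 \<Rightarrow> 'a" where
  "bil_form A v w = (\<Sum>i\<in>UNIV. \<Sum>j\<in>UNIV. A $ i $ j * v $ i * w $ j)"

lemma bil_form_add_scale [simp]:
  "bil_form A (v + v') w = bil_form A v w + bil_form A v' w"
  "bil_form A v (w + w') = bil_form A v w + bil_form A v w'"
  "bil_form A (k *s v) w = k * bil_form A v w"
  "bil_form A v (k *s w) = k * bil_form A v w"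
  by (simp_all add: bil_form_def sum.distrib sum_distrib_left algebra_simps)

lemma qform_eq_bil_form: "qform A v = bil_form A v v"
  by (simp add: qform_def bil_form_def)

lemma polar_form_eq_bil_form: "polar_form A v w = bil_form A v w + bil_form A w v"
  by (simp add: polar_form_def qform_eq_bil_form)

lemma qform_add: "qform A (v + w) = qform A v + qform A w + polar_form A v w"
  by (simp add: polar_form_def)

lemma qform_scale: "qform A (k *s v) = k\<^sup>2 * qform A v"
  by (simp add: qform_eq_bil_form power2_eq_square)

lemma polar_form_bilinear:
  "polar_form A (v + v') w = polar_form A v w + polar_form A v' w"
  "polar_form A v (w + w') = polar_form A v w + polar_form A v w'"
  "polar_form A (k *s v) w = k * polar_form A v w"
  "polar_form A v (k *s w) = k * polar_form A v w"
  by (simp_all add: polar_form_eq_bil_form algebra_simps)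

lemma polar_form_commute: "polar_form A v w = polar_form A w v"
  by (simp add: polar_form_eq_bil_form)

lemma span2_iff: "w \<in> vec.span {u, v} \<longleftrightarrow> (\<exists>a b. w = a *s u + b *s (v :: 'a::field^'n))"
proof -
  have "w - a *s u = b *s v \<longleftrightarrow> w = a *s u + b *s v" for a b
    by (simp add: diff_eq_eq add.commute)
  then show ?thesis by (simp add: vec.span_breakdown_eq vec.span_singleton image_iff)
qed

definition quadric :: "'a::field^3^3 \<Rightarrow> ('a^3) set set" where
  "quadric A = {p \<in> pg_points. \<forall>v\<in>p. qform A v = 0}"

lemma span_in_quadric_iff: "v \<noteq> 0 \<Longrightarrow> vec.span {v} \<in> quadric A \<longleftrightarrow> qform A v = 0"
proof -
  assume v: "v \<noteq> 0"
  have "vec.span {v} \<in> quadric A \<longleftrightarrow> (\<forall>u\<in>vec.span {v}. qform A u = 0)"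
    using pg_points_spanI[OF v] by (simp add: quadric_def)
  also have "\<dots> \<longleftrightarrow> qform A v = 0"
    by (auto simp: vec.span_singleton qform_scale dest: spec[of _ 1])
  finally show ?thesis .
qed

lemma quadricE:
  assumes "p \<in> quadric A"
  obtains v where "v \<noteq> 0" "p = vec.span {v}" "qform A v = 0"
  using assms by (metis (no_types, lifting) mem_Collect_eq pg_points_iff quadric_def span_in_quadric_iff)

section \<open>The nucleus and the normal form of a conic\<close>

context even_order_field
begin

lemma polar_form_self: "polar_form A v v = (0::'a)"
  by (simp add: polar_form_eq_bil_form)

lemma nondegenerateD: "nondegenerate A \<Longrightarrow> v \<noteq> 0 \<Longrightarrow> (\<And>w. polar_form A v w = 0) \<Longrightarrow> qform A v \<noteq> (0::'a)"
  by (auto simp: nondegenerate_def)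

text \<open>On orthogonal vectors the form is Q(u) x^2 + Q(v) y^2, which vanishes when x^2 = Q(v)
  and y^2 = Q(u).\<close>

lemma ex_isotropic_combination:
  assumes "polar_form A u v = (0::'a)"
  obtains x y where "(x, y) \<noteq> (0, 0)" "qform A (x *s u + y *s v) = 0"
proof (cases "qform A u = 0")
  case True
  then show ?thesis using that[of 1 0] by (simp add: qform_scale)
next
  case False
  then have "sqroot (qform A u) \<noteq> 0" by (metis sqroot_square zero_power2)
  moreover have "qform A (sqroot (qform A v) *s u + sqroot (qform A u) *s v) = 0"
    by (simp add: qform_add qform_scale polar_form_bilinear assms mult.commute)
  ultimately show ?thesis using that by blast
qed

text \<open>The kernel of the alternating form, which in odd dimension is nonzero.\<close>

lemma ex_polar_kernel:
  assumes "nondegenerate (A :: 'a^3^3)"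
  obtains k where "k \<noteq> 0" "\<And>w. polar_form A k w = 0"
proof -
  \<comment> \<open>These are the entries of the alternating matrix. In characteristic 2 the polar
    form of v and w is the determinant of (f, g, h), v and w, so this vector lies in the
    kernel.\<close>
  define f g h where fgh: "f = A $ 2 $ 3 + A $ 3 $ 2" "g = A $ 1 $ 3 + A $ 3 $ 1" "h = A $ 1 $ 2 + A $ 2 $ 1"
  have polar: "polar_form A v w = f * (v $ 2 * w $ 3 + v $ 3 * w $ 2) +
      g * (v $ 1 * w $ 3 + v $ 3 * w $ 1) + h * (v $ 1 * w $ 2 + v $ 2 * w $ 1)" for v w
    unfolding polar_form_eq_bil_form bil_form_def sum_3 fgh by (simp add: algebra_simps)
  let ?k = "vector [f, g, h] :: 'a^3"
  have "polar_form A ?k w = 0" for w unfolding polar by (simp add: algebra_simps)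
  moreover have "?k \<noteq> 0"
  proof
    assume "?k = 0"
    then have 0: "polar_form A v w = 0" for v w by (simp add: polar vector3_eq_0_iff)
    obtain x y where xy: "(x, y) \<noteq> (0, 0)"
        "qform A (x *s vector [1, 0, 0] + y *s vector [0, 1, 0]) = 0"
      using ex_isotropic_combination[OF 0] by metis
    moreover have "x *s vector [1, 0, 0] + y *s vector [0, 1, 0] \<noteq> (0 :: 'a^3)"
      using xy(1) by (auto simp: vec3_eq_iff)
    ultimately show False using nondegenerateD[OF assms] 0 by blast
  qed
  ultimately show ?thesis using that by blast
qed

text \<open>Every line through the kernel point \<open>k\<close> is tangent, so the nucleus lies on
  all of them and must be that point.\<close>

lemma polar_form_nucleus:
  assumes A: "nondegenerate (A :: 'a^3^3)" and n: "is_nucleus (quadric A) n" and u: "u \<in> n"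
  shows "polar_form A u w = 0"
proof -
  obtain k where k: "k \<noteq> 0" "\<And>w. polar_form A k w = 0" using ex_polar_kernel[OF A] by blast
  have Qk: "qform A k \<noteq> 0" using nondegenerateD[OF A k] .
  have tangent: "n \<subseteq> vec.span {k, v}" if v: "v \<notin> vec.span {k}" for v
  proof -
    \<comment> \<open>This makes \<open>t *s k + v\<close> a zero of the form. On the line, Q(a k +
      b v) = (a + b t)^2 Q(k), so there is no other point of the conic.\<close>
    define t where "t = sqroot (qform A v / qform A k)"
    have t: "qform A v = t\<^sup>2 * qform A k" using Qk by (simp add: t_def)
    let ?v = "t *s k + v"
    have v0: "?v \<noteq> 0"
    proof
      assume "?v = 0"
      then have "v = t *s k" by (simp add: vec3_eq_iff add_eq_0_iff_eq)
      then show False using v unfolding vec.span_singleton by blast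
    qed
    have l: "vec.span {k, v} \<in> pg_lines" using k(1) v by (rule span2_pg_line)
    have "points_on (quadric A) (vec.span {k, v}) = {vec.span {?v}}"
    proof (intro equalityI subsetI)
      fix p assume "p \<in> points_on (quadric A) (vec.span {k, v})"
      then have p: "p \<in> quadric A" "p \<subseteq> vec.span {k, v}" by (auto simp: points_on_def)
      obtain w where w: "w \<noteq> 0" "p = vec.span {w}" "qform A w = 0" using p(1) by (rule quadricE)
      then have "w \<in> vec.span {k, v}" using p(2) by (simp add: span_subset_iff)
      then obtain a b where ab: "w = a *s k + b *s v" by (auto simp: span2_iff)
      have "qform A w = (a + b * t)\<^sup>2 * qform A k"
        by (simp add: ab qform_add qform_scale polar_form_bilinear k(2) t add_square power_mult_distrib
            algebra_simps)
      then have "a = b * t" using w(3) Qk by (simp add: add_eq_0_iff_eq)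
      then have "w = b *s ?v" by (simp add: ab algebra_simps)
      then have "w \<in> vec.span {?v}" unfolding vec.span_singleton by blast
      then show "p \<in> {vec.span {?v}}" using span_singleton_eqI w(1,2) by blast
    next
      fix p assume "p \<in> {vec.span {?v}}"
      moreover have "qform A ?v = 0"
        by (simp add: qform_add qform_scale polar_form_bilinear k(2) t)
      moreover have "?v \<in> vec.span {k, v}"
        unfolding span2_iff by (intro exI[of _ t] exI[of _ 1]) simp
      ultimately show "p \<in> points_on (quadric A) (vec.span {k, v})"
        using v0 by (simp add: points_on_def span_in_quadric_iff span_subset_iff)
    qed
    then have "tangent_line (quadric A) (vec.span {k, v})" using l by (simp add: tangent_line_def)
    then show ?thesis using n unfolding is_nucleus_def by blast
  qed
  obtain m where m: "n = vec.span {m}" "m \<noteq> 0" using n by (auto simp: is_nucleus_def pg_points_iff)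
  have "m \<in> vec.span {k}"
  proof (rule ccontr)
    assume mk: "m \<notin> vec.span {k}"
    have "vec.span {k, m} \<in> pg_lines" using k(1) mk by (rule span2_pg_line)
    then have dim: "vec.dim (vec.span {k, m}) = 2" unfolding pg_lines_def by blast
    have "vec.span {k, m} \<noteq> UNIV"
    proof
      assume "vec.span {k, m} = UNIV"
      then have "CARD(3) = (2::nat)" using dim by (simp only: vec_dim_card)
      then show False by simp
    qed
    \<comment> \<open>The line joining \<open>k\<close> to a point \<open>v\<close> off the line of
      \<open>k\<close> and \<open>m\<close> is tangent but avoids \<open>m\<close>.\<close>
    then obtain v where v: "v \<notin> vec.span {k, m}" by blast
    moreover have "vec.span {k} \<subseteq> vec.span {k, m}" by (rule vec.span_mono) simp
    ultimately have "n \<subseteq> vec.span {k, v}" using tangent by blast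
    then have "m \<in> vec.span {k, v}" using m by (simp add: span_subset_iff)
    then obtain a b where ab: "m = a *s k + b *s v" by (auto simp: span2_iff)
    show False
    proof (cases "b = 0")
      case True
      then show False using ab mk by (auto simp: vec.span_singleton)
    next
      case False
      then have "v = (a / b) *s k + inverse b *s m"
        by (simp add: ab vec3_eq_iff field_simps)
      then show False using v unfolding span2_iff by blast
    qed
  qed
  then have "n \<subseteq> vec.span {k}" using m(1) by (simp add: span_subset_iff)
  then obtain c where "u = c *s k" using u by (auto simp: vec.span_singleton)
  then show ?thesis by (simp add: polar_form_bilinear k(2))
qed

text \<open>With the nucleus as third base point the polar form removes the terms xz and yz.
  Nondegeneracy makes the coefficients of z^2 and xy nonzero, and division by the latter gives the
  normal form.\<close>

lemma conic_eq_change_coords: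
  assumes B: "invertible B" "change_coords B F0 = n"
    and C: "is_conic C" "is_nucleus C n"
  obtains g where "weight g \<noteq> 0" "C = change_coords B ` conic_of g"
proof -
  obtain A where A: "nondegenerate A" "C = quadric A"
    using C(1) by (auto simp: is_conic_def quadric_def)
  define u1 u2 u3 where u: "u1 = B *v vector [1, 0, 0]" "u2 = B *v vector [0, 1, 0]" "u3 = B *v vector [0, 0, 1]"
  have Bv: "B *v v = v $ 1 *s u1 + v $ 2 *s u2 + v $ 3 *s u3" for v
    by (simp add: u vec3_eq_iff matrix_vector_mult_def sum_3 algebra_simps)
  have B0: "B *v v = 0 \<longleftrightarrow> v = 0" for v
    using inj_matrix[OF B(1)] by (metis injD matrix_vector_mult_0_right)
  have "u3 \<in> n"
    unfolding B(2)[symmetric] u(3) F0_def change_coords_def by (intro imageI vec.span_base) simp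
  then have u3: "polar_form A u3 w = 0" "polar_form A w u3 = 0" for w
    using polar_form_nucleus[OF A(1)] C(2) A(2) polar_form_commute by metis+
  define h where "h = polar_form A u1 u2"
  have Q: "qform A (B *v v) = qform A u1 * (v $ 1)\<^sup>2 + h * (v $ 1 * v $ 2) + qform A u2 * (v $ 2)\<^sup>2 +
      qform A u3 * (v $ 3)\<^sup>2" for v
    by (simp add: Bv qform_add qform_scale polar_form_bilinear u3 h_def algebra_simps)
  have "u3 \<noteq> 0" unfolding u by (simp add: B0 vector3_eq_0_iff)
  then have c: "qform A u3 \<noteq> 0" using u3(1) by (rule nondegenerateD[OF A(1)])
  \<comment> \<open>If h = 0, then \<open>u1\<close> and \<open>u2\<close> are orthogonal and an
    isotropic combination of them lies in the radical.\<close>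
  have h: "h \<noteq> 0"
  proof
    assume h0: "h = 0"
    have polar: "polar_form A (x *s u1 + y *s u2) (B *v w) = 0" for x y w
      using h0 polar_form_commute[of A u2 u1]
      by (simp add: Bv polar_form_bilinear u3 polar_form_self h_def)
    have surj: "\<exists>v. w = B *v v" for w
      by (metis B(1) matrix_inv_right matrix_vector_mul_assoc matrix_vector_mul_lid)
    obtain x y where xy: "(x, y) \<noteq> (0, 0)" "qform A (x *s u1 + y *s u2) = 0"
      using ex_isotropic_combination h0 unfolding h_def by metis
    have "x *s u1 + y *s u2 = B *v vector [x, y, 0]" by (simp add: Bv)
    then have "x *s u1 + y *s u2 \<noteq> 0" using xy(1) by (auto simp: B0 vector3_eq_0_iff)
    then show False using nondegenerateD[OF A(1)] xy(2) polar surj by metis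
  qed
  define \<mu> where "\<mu> = qform A u3 / h"
  \<comment> \<open>The factor \<mu> is there because \<open>param_of\<close> divides by the
    weight.\<close>
  define g where "g = (qform A u1 / h * \<mu>, qform A u2 / h * \<mu>, \<mu>)"
  have \<mu>: "\<mu> \<noteq> 0" using c h by (simp add: \<mu>_def)
  have "param_of g = (qform A u1 / h, qform A u2 / h, qform A u3 / h)"
    using \<mu> by (simp add: param_of_def g_def) (simp add: \<mu>_def)
  then have form: "qform A (B *v v) = h * conic_form (param_of g) v" for v
    using h by (simp add: Q conic_form_def algebra_simps)
  have "C = change_coords B ` conic_of g"
  proof (intro equalityI subsetI)
    fix p assume "p \<in> C"
    then obtain w where w: "w \<noteq> 0" "p = vec.span {w}" "qform A w = 0"
      unfolding A(2) by (rule quadricE)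
    have Bw: "B *v (matrix_inv B *v w) = w"
      by (metis B(1) matrix_inv_right matrix_vector_mul_assoc matrix_vector_mul_lid)
    have "matrix_inv B *v w \<noteq> 0" using w(1) Bw B0 by metis
    moreover have "conic_form (param_of g) (matrix_inv B *v w) = 0"
      using form[of "matrix_inv B *v w"] w(3) h by (simp add: Bw)
    ultimately have "vec.span {matrix_inv B *v w} \<in> conic_of g"
      by (simp add: span_in_mathon_conic_iff)
    moreover have "p = change_coords B (vec.span {matrix_inv B *v w})"
      by (simp add: w(2) change_coords_span Bw)
    ultimately show "p \<in> change_coords B ` conic_of g" by blast
  next
    fix p assume "p \<in> change_coords B ` conic_of g"
    then obtain q where q: "q \<in> conic_of g" "p = change_coords B q" by blast
    obtain v where v: "v \<noteq> 0" "q = vec.span {v}" "conic_form (param_of g) v = 0"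
      using q(1) by (rule mathon_conicE)
    then show "p \<in> C"
      by (simp add: q(2) A(2) change_coords_span span_in_quadric_iff B0 form)
  qed
  moreover have "weight g \<noteq> 0" using \<mu> by (simp add: weight_def g_def)
  ultimately show ?thesis using that by blast
qed

end

theorem theorem2:
  fixes M C :: "('a::{field,finite}^3) set set"
    and \<K> :: "('a^3) set set set"
    and n :: "('a^3) set"
    and d h :: nat
  assumes q: "CARD('a) = 2 ^ h"
    and M: "maximal_arc d M" "mathon_type M"
    and d: "2 * d < CARD('a)"
    and conics: "card \<K> = d - 1" "\<And>K. K \<in> \<K> \<Longrightarrow> is_conic K \<and> is_nucleus K n"
      "M = insert n (\<Union>\<K>)"
    and C: "is_conic C" "is_nucleus C n" "C \<inter> M = {}"
  shows "\<exists>!M'. maximal_arc (2 * d) M' \<and> mathon_type M' \<and> M \<union> C \<subseteq> M'"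
proof -
  interpret even_order_field h "TYPE('a)" by unfold_locales (rule q)
  have "n \<in> pg_points" using C(2) by (simp add: is_nucleus_def)
  \<comment> \<open>The matrix moves \<open>F0\<close> to the common nucleus; the whole
    configuration is pulled back along it, extended there, and carried forward again.\<close>
  then obtain B where B: "invertible B" "change_coords B F0 = n" by (rule ex_change_coords_F0)
  let ?A = "change_coords B" and ?A' = "change_coords (matrix_inv B)"
  have inv: "?A ` ?A' ` S = S" "?A' ` ?A ` S = S" for S
    by (simp_all add: image_image B(1))
  have "\<forall>K\<in>\<K>. \<exists>g. weight g \<noteq> 0 \<and> K = ?A ` conic_of g"
    using conic_eq_change_coords[OF B] conics(2) by metis
  then obtain G where G: "\<And>K. K \<in> \<K> \<Longrightarrow> weight (G K) \<noteq> 0"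
      "\<And>K. K \<in> \<K> \<Longrightarrow> K = ?A ` conic_of (G K)"
    by metis
  obtain c where c: "weight c \<noteq> 0" "C = ?A ` conic_of c"
    using conic_eq_change_coords[OF B C(1,2)] by metis
  have M0: "?A' ` M = insert F0 (\<Union>g\<in>G ` \<K>. conic_of g)"
  proof -
    have "M = insert (?A F0) (\<Union>K\<in>\<K>. ?A ` conic_of (G K))"
      using conics(3) B(2) G(2) by simp
    also have "\<dots> = ?A ` insert F0 (\<Union>g\<in>G ` \<K>. conic_of g)"
      by (simp add: image_UN)
    finally show ?thesis by (simp only: inv)
  qed
  \<comment> \<open>A conic is recovered from its triple, so there are exactly d - 1
    triples.\<close>
  have "inj_on G \<K>" by (rule inj_onI) (metis G(2))
  then have card: "card (G ` \<K>) = d - 1" by (simp add: card_image conics(1))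
  have arc0: "maximal_arc d (?A' ` M)"
    using M(1) B(1) by (simp add: maximal_arc_change_coords invertible_matrix_inv)
  have disj: "conic_of c \<inter> ?A' ` M = {}"
  proof -
    have "?A ` (conic_of c \<inter> ?A' ` M) = C \<inter> M"
      by (simp only: image_Int[OF inj_change_coords[OF B(1)]] inv c(2))
    then show ?thesis using C(3) by simp
  qed
  have weight: "weight g \<noteq> 0" if "g \<in> G ` \<K>" for g using that G(1) by blast
  obtain M' where M': "maximal_arc (2 * d) M'" "mathon_type M'" "?A' ` M \<union> conic_of c \<subseteq> M'"
      "\<And>M''. maximal_arc (2 * d) M'' \<Longrightarrow> ?A' ` M \<union> conic_of c \<subseteq> M'' \<Longrightarrow> M'' = M'"
    using arc_extension[OF arc0 M0 d weight card c(1) disj] by metis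
  have MC: "?A ` (?A' ` M \<union> conic_of c) = M \<union> C" by (simp only: image_Un inv c(2))
  show ?thesis
  proof (rule ex1I[of _ "?A ` M'"])
    show "maximal_arc (2 * d) (?A ` M') \<and> mathon_type (?A ` M') \<and> M \<union> C \<subseteq> ?A ` M'"
      using M'(1-3) B(1) MC
      by (metis image_mono maximal_arc_change_coords mathon_type_change_coords)
  next
    fix M'' assume M'': "maximal_arc (2 * d) M'' \<and> mathon_type M'' \<and> M \<union> C \<subseteq> M''"
    then have "maximal_arc (2 * d) (?A' ` M'')"
      using B(1) by (simp add: maximal_arc_change_coords invertible_matrix_inv)
    moreover have "?A' ` M \<union> conic_of c \<subseteq> ?A' ` M''"
      using M'' MC by (metis image_mono inv(2))
    ultimately have "?A' ` M'' = M'" by (rule M'(4))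
    then show "M'' = ?A ` M'" using inv(1) by metis
  qed
qed

end
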